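(* Assume the standing setting below with a continuous loss function $w:\Theta\times U\to[0,\infty)$. Then there exists a least favorable prior, i.e., some $\pi_{LF}\in\mathcal{P}(\Theta)$ with $$\inf_{M\in\mathrm{Povm}(U)}\int R_M(\theta)\,\pi_{LF}(d\theta)=\sup_{\pi\in\mathcal{P}(\Theta)}\inf_{M\in\mathrm{Povm}(U)}\int R_M(\theta)\,\pi(d\theta).$$ Moreover, every minimax POVM is a Bayes POVM with respect to $\pi_{LF}$: if $M_*\in\mathrm{Povm}(U)$ satisfies $\sup_\theta R_{M_*}(\theta)=\inf_{M\in\mathrm{Povm}(U)}\sup_\theta R_M(\theta)$, then $\int R_{M_*}\,d\pi_{LF}=\inf_{M\in\mathrm{Povm}(U)}\int R_M\,d\pi_{LF}$.
   Context: Standing setting. $\mathcal{H}$ is a complex Hilbert space and $L_1(\mathcal{H})$ the trace-class operators on it; for self-adjoint operators $A\ge B$ means $A-B$ is positive. $\Theta$ and $U$ are compact metric spaces ($d$ the metric on $\Theta$). For compact $K\subseteq\Theta$ and $\delta>0$ let $K_\delta:=\{(\theta,\eta)\in K\times K: d(\theta,\eta)<\delta\}$. For $T:\Theta\to L_1(\mathcal{H})$ with self-adjoint values, $\omega_T(K_\delta):=\inf\{\|X\|_1: X\in L_1(\mathcal{H}),\ -X\le T(\theta)-T(\eta)\le X\ \forall(\theta,\eta)\in K_\delta\}$ (infimum of the empty set is $+\infty$), and $T$ is called regular if $\lim_{\delta\to0}\omega_T(K_\delta)=0$ for every compact $K\subseteq\Theta$. A quantum statistical model is a map $\rho:\Theta\to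 L_1(\mathcal{H})$ with $\rho(\theta)\ge0$, $\mathrm{Tr}\,\rho(\theta)=1$, which is injective (identifiability) and regular. A POVM on $U$ is a map $M$ from the Borel $\sigma$-algebra of $U$ to bounded operators on $\mathcal{H}$ with $M(B)\ge0$, $M(\bigcup_j B_j)=\sum_j M(B_j)$ for pairwise disjoint $B_j$ (series converging in the weak operator topology), and $M(U)=I$; $\mathrm{Povm}(U)$ is the set of all POVMs. The risk function of $M$ is $R_M(\theta):=\int_U w(\theta,u)\,\mathrm{Tr}\,\rho(\theta)M(du)$. $\mathcal{P}(\Theta)$ denotes the set of Borel probability measures on $\Theta$. A Bayes POVM with respect to $\pi\in\mathcal{P}(\Theta)$ is a minimizer over $\mathrm{Povm}(U)$ of $M\mapsto\int R_M\,d\pi$. *)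

theory Defs
  imports "HOL-Analysis.Analysis" "HOL-Probability.Probability"
begin

text \<open>Complex inner product space; the inner product is conjugate-linear in the
first and linear in the second argument (physics convention).\<close>

class complex_inner = ab_group_add +
  fixes scaleC :: "complex \<Rightarrow> 'a \<Rightarrow> 'a"
    and cinner :: "'a \<Rightarrow> 'a \<Rightarrow> complex"
  assumes scaleC_add_right: "scaleC a (x + y) = scaleC a x + scaleC a y"
    and scaleC_add_left: "scaleC (a + b) x = scaleC a x + scaleC b x"
    and scaleC_scaleC: "scaleC a (scaleC b x) = scaleC (a * b) x"
    and scaleC_one: "scaleC 1 x = x"
    and cinner_add_right: "cinner x (y + z) = cinner x y + cinner x z"
    and cinner_scaleC_right: "cinner x (scaleC a y) = a * cinner x y"
    and cinner_commute: "cinner y x = cnj (cinner x y)"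
    and cinner_nonneg: "0 \<le> Re (cinner x x)"
    and cinner_eq_zero_iff: "cinner x x = 0 \<longleftrightarrow> x = 0"

definition cnorm :: "'a::complex_inner \<Rightarrow> real" where
  "cnorm x = sqrt (Re (cinner x x))"

class chilbert = complex_inner +
  assumes cauchy_converges:
    "(\<forall>e>0. \<exists>N. \<forall>m\<ge>N. \<forall>n\<ge>N. sqrt (Re (cinner (X m - X n) (X m - X n))) < e)
       \<Longrightarrow> \<exists>L. (\<lambda>n. sqrt (Re (cinner (X n - L) (X n - L)))) \<longlonglongrightarrow> 0"

definition bounded_op :: "('a::complex_inner \<Rightarrow> 'a) \<Rightarrow> bool" where
  "bounded_op A \<longleftrightarrow> (\<forall>x y. A (x + y) = A x + A y) \<and> (\<forall>c x. A (scaleC c x) = scaleC c (A x))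
     \<and> (\<exists>C. \<forall>x. cnorm (A x) \<le> C * cnorm x)"

definition pos_op :: "('a::complex_inner \<Rightarrow> 'a) \<Rightarrow> bool" where
  "pos_op A \<longleftrightarrow> (\<forall>x. Im (cinner x (A x)) = 0 \<and> 0 \<le> Re (cinner x (A x)))"

definition op_le :: "('a::complex_inner \<Rightarrow> 'a) \<Rightarrow> ('a \<Rightarrow> 'a) \<Rightarrow> bool" where
  "op_le A B \<longleftrightarrow> pos_op (\<lambda>x. B x - A x)"

definition orthonormal_fam :: "nat \<Rightarrow> (nat \<Rightarrow> 'a::complex_inner) \<Rightarrow> bool" where
  "orthonormal_fam n e \<longleftrightarrow> (\<forall>i<n. \<forall>j<n. cinner (e i) (e j) = (if i = j then 1 else 0))"

definition trace_norm :: "('a::complex_inner \<Rightarrow> 'a) \<Rightarrow> ereal" where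
  "trace_norm A = (SUP (n, e, f) \<in> {(n, e, f). orthonormal_fam n e \<and> orthonormal_fam n f}.
       ereal (\<Sum>i<n. cmod (cinner (f i) (A (e i)))))"

definition trace_class :: "('a::complex_inner \<Rightarrow> 'a) \<Rightarrow> bool" where
  "trace_class A \<longleftrightarrow> bounded_op A \<and> trace_norm A < \<infinity>"

definition onb :: "'a::complex_inner set \<Rightarrow> bool" where
  "onb B \<longleftrightarrow> (\<forall>x\<in>B. cinner x x = 1) \<and> (\<forall>x\<in>B. \<forall>y\<in>B. x \<noteq> y \<longrightarrow> cinner x y = 0)
     \<and> (\<forall>x. (\<forall>e\<in>B. cinner e x = 0) \<longrightarrow> x = 0)"

definition ctrace :: "('a::complex_inner \<Rightarrow> 'a) \<Rightarrow> complex" where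
  "ctrace A = infsum (\<lambda>e. cinner e (A e)) (SOME B. onb B)"

definition omega :: "('t::metric_space \<Rightarrow> 'a::complex_inner \<Rightarrow> 'a) \<Rightarrow> 't set \<Rightarrow> real \<Rightarrow> ereal" where
  "omega T K \<delta> = (INF X \<in> {X. trace_class X \<and>
        (\<forall>\<theta>\<in>K. \<forall>\<eta>\<in>K. dist \<theta> \<eta> < \<delta> \<longrightarrow>
           op_le (\<lambda>x. - X x) (\<lambda>x. T \<theta> x - T \<eta> x) \<and> op_le (\<lambda>x. T \<theta> x - T \<eta> x) X)}.
      trace_norm X)"

definition regular :: "('t::metric_space \<Rightarrow> 'a::complex_inner \<Rightarrow> 'a) \<Rightarrow> bool" where
  "regular T \<longleftrightarrow> (\<forall>K. compact K \<longrightarrow> ((\<lambda>\<delta>. omega T K \<delta>) \<longlongrightarrow> 0) (at_right 0))"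

definition quantum_model :: "('t::metric_space \<Rightarrow> 'a::complex_inner \<Rightarrow> 'a) \<Rightarrow> bool" where
  "quantum_model \<rho> \<longleftrightarrow> (\<forall>\<theta>. trace_class (\<rho> \<theta>) \<and> pos_op (\<rho> \<theta>) \<and> ctrace (\<rho> \<theta>) = 1)
     \<and> inj \<rho> \<and> regular \<rho>"

text \<open>A POVM on the Borel sets of U (set to 0 outside the Borel sets, so that it is
  determined by its values on the Borel \<sigma>-algebra).\<close>
definition Povm :: "('u::topological_space set \<Rightarrow> 'a::complex_inner \<Rightarrow> 'a) set" where
  "Povm = {M. (\<forall>B\<in>sets borel. bounded_op (M B) \<and> pos_op (M B))
     \<and> (\<forall>Bs::nat \<Rightarrow> 'u set. range Bs \<subseteq> sets borel \<longrightarrow> disjoint_family Bs \<longrightarrow>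
          (\<forall>x y. (\<lambda>j. cinner x (M (Bs j) y)) sums cinner x (M (\<Union>j. Bs j) y)))
     \<and> M UNIV = id
     \<and> (\<forall>B. B \<notin> sets borel \<longrightarrow> M B = (\<lambda>_. 0))}"

definition outcome_measure :: "('a::complex_inner \<Rightarrow> 'a) \<Rightarrow> ('u::topological_space set \<Rightarrow> 'a \<Rightarrow> 'a) \<Rightarrow> 'u measure" where
  "outcome_measure r M = measure_of UNIV (sets borel) (\<lambda>B. ennreal (Re (ctrace (\<lambda>x. r (M B x)))))"

definition risk :: "('t \<Rightarrow> 'a::complex_inner \<Rightarrow> 'a) \<Rightarrow> ('t \<Rightarrow> 'u::topological_space \<Rightarrow> real)
     \<Rightarrow> ('u set \<Rightarrow> 'a \<Rightarrow> 'a) \<Rightarrow> 't \<Rightarrow> real" where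
  "risk \<rho> w M \<theta> = (\<integral>u. w \<theta> u \<partial>outcome_measure (\<rho> \<theta>) M)"

definition priors :: "'t::topological_space measure set" where
  "priors = {\<pi>. prob_space \<pi> \<and> sets \<pi> = sets borel}"

end

theory Submission
  imports Defs
begin

text \<open>
  Let \<open>c\<close> be the minimax risk. It suffices to find one prior \<open>\<pi>\<close> whose Bayes risks
  \<open>\<integral>R\<^sub>M d\<pi>\<close> are all at least \<open>c\<close>: every prior has Bayes value at most \<open>c\<close>, so \<open>\<pi>\<close> is least
  favorable, and a minimax \<open>M\<close> satisfies \<open>c \<le> \<integral>R\<^sub>M d\<pi> \<le> sup R\<^sub>M = c\<close>. The map
  \<open>M \<mapsto> R\<^sub>M\<close> is affine on a convex set and, by regularity, the functions \<open>R\<^sub>M\<close> are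
  equicontinuous uniformly in \<open>M\<close>. On a finite net of \<open>\<Theta>\<close> separation of convex sets gives
  weights whose Bayes risks are at least \<open>c - \<epsilon>\<close> for all \<open>M\<close> at once; a weak limit of these
  discrete priors for \<open>\<epsilon> \<rightarrow> 0\<close> is \<open>\<pi>\<close>.

  The trace pairing of a positive trace-class \<open>r\<close> with a positive \<open>A\<close> is handled through an
  expansion \<open>r = \<Sum>\<^sub>k |v\<^sub>k><v\<^sub>k|\<close>, obtained by Cholesky elimination along an orthonormal basis, so
  that \<open>Tr r A = \<Sum>\<^sub>k <v\<^sub>k, A v\<^sub>k>\<close>. Weak limits of priors are constructed as images of
  Lebesgue measure on \<open>[0, 1)\<close> under a limit of step functions.
\<close>

section \<open>Complex inner product spaces and orthonormal bases\<close>

text \<open>\<open>ctrace\<close> is a diagonal sum over one chosen basis, and for positive r and A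
  the product r A is in general not even self-adjoint. Hence it is not visible that
  \<open>Tr r M(B)\<close> is nonnegative or countably additive in B, while
  \<open>measure_of\<close> returns the zero measure for set functions that are not. The cure is an
  expansion whose vectors v do not depend on A: the outcome distribution becomes a sum of
  nonnegative measures \<open><v, M(B) v>\<close>, and weak additivity of M applies to each of them.
  Equicontinuity is uniform in M because, once the loss is bounded by a constant, the dominating
  operator X of regularity enters only through the total mass \<open>Tr X M(U) = Tr X\<close>, which
  the trace norm bounds whatever M is. This uniformity lets a finite net replace the parameter space
  at a cost independent of M. The compactness that closes the argument is that of the set of priors:
  in the limit a bound has to be kept for one continuous function R_M at a time.\<close>

lemma cinner_add_left: "cinner (x + y) z = cinner x z + cinner (y::'a::complex_inner) z"
  by (metis cinner_add_right cinner_commute complex_cnj_add)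

lemma cinner_scaleC_left: "cinner (scaleC a x) y = cnj a * cinner (x::'a::complex_inner) y"
  by (metis cinner_scaleC_right cinner_commute complex_cnj_mult)

lemma cinner_zero_right [simp]: "cinner (x::'a::complex_inner) 0 = 0"
  using cinner_add_right[of x 0 0] by simp

lemma cinner_zero_left [simp]: "cinner 0 (x::'a::complex_inner) = 0"
  using cinner_add_left[of 0 0 x] by simp

lemma cinner_minus_right: "cinner (x::'a::complex_inner) (- y) = - cinner x y"
  using cinner_add_right[of x y "- y"] by (simp add: minus_unique)

lemma cinner_minus_left: "cinner (- x) (y::'a::complex_inner) = - cinner x y"
  using cinner_add_left[of x "- x" y] by (simp add: minus_unique)

lemma cinner_diff_right: "cinner (x::'a::complex_inner) (y - z) = cinner x y - cinner x z"
  using cinner_add_right[of x y "- z"] by (simp add: cinner_minus_right)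

lemma cinner_diff_left: "cinner (x - y) (z::'a::complex_inner) = cinner x z - cinner y z"
  using cinner_add_left[of x "- y" z] by (simp add: cinner_minus_left)

lemmas cinner_simps = cinner_add_left cinner_add_right cinner_diff_left cinner_diff_right
  cinner_scaleC_left cinner_scaleC_right cinner_minus_left cinner_minus_right

lemma cinner_sum_right: "cinner (x::'a::complex_inner) (sum f F) = (\<Sum>i\<in>F. cinner x (f i))"
  by (induction F rule: infinite_finite_induct) (auto simp: cinner_simps)

lemma Im_cinner_self [simp]: "Im (cinner x (x::'a::complex_inner)) = 0"
  using arg_cong[OF cinner_commute[of x x], of Im] by simp

lemma cinner_self_real: "cinner x (x::'a::complex_inner) = complex_of_real (Re (cinner x x))"
  by (simp add: complex_eq_iff)

lemma cmod_cinner_commute: "cmod (cinner x y) = cmod (cinner y (x::'a::complex_inner))"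
  by (metis cinner_commute complex_mod_cnj)

definition linear_op :: "('a::complex_inner \<Rightarrow> 'a) \<Rightarrow> bool" where
  "linear_op A \<longleftrightarrow> (\<forall>x y. A (x + y) = A x + A y) \<and> (\<forall>c x. A (scaleC c x) = scaleC c (A x))"

lemma linear_op_add: "linear_op A \<Longrightarrow> A (x + y) = A x + A y"
  and linear_op_scaleC: "linear_op A \<Longrightarrow> A (scaleC c x) = scaleC c (A x)"
  by (auto simp: linear_op_def)

lemma linear_op_zero: "linear_op A \<Longrightarrow> A 0 = 0"
  using linear_op_add[of A 0 0] by simp

lemma linear_op_diff: "linear_op A \<Longrightarrow> A (x - y) = A x - A y"
  using linear_op_add[of A "x - y" y] by simp

lemma linear_op_sum: "linear_op A \<Longrightarrow> A (sum f F) = (\<Sum>i\<in>F. A (f i))"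
  by (induction F rule: infinite_finite_induct) (auto simp: linear_op_add linear_op_zero)

lemma bounded_op_linear: "bounded_op A \<Longrightarrow> linear_op A"
  by (simp add: bounded_op_def linear_op_def)

text \<open>Polarisation: reality of the quadratic form at x + y fixes the imaginary part of the
  symmetry, reality at x + i y the real part.\<close>

lemma pos_op_hermitian:
  fixes A :: "'a::complex_inner \<Rightarrow> 'a"
  assumes A: "linear_op A" "pos_op A"
  shows "cinner x (A y) = cinner (A x) y"
proof -
  have im: "Im (cinner z (A z)) = 0" for z
    using A(2) by (simp add: pos_op_def)
  have 1: "Im (cinner x (A y)) + Im (cinner y (A x)) = 0"
    using im[of "x + y"] im[of x] im[of y] by (simp add: linear_op_add[OF A(1)] cinner_simps)
  have 2: "Re (cinner x (A y)) - Re (cinner y (A x)) = 0"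
    using im[of "x + scaleC \<i> y"] im[of x] im[of y]
    by (simp add: linear_op_add[OF A(1)] linear_op_scaleC[OF A(1)] cinner_simps)
  have "cinner x (A y) = cnj (cinner y (A x))"
    using 1 2 by (simp add: complex_eq_iff)
  then show ?thesis
    by (metis cinner_commute)
qed

text \<open>The form \<open><x, A y>\<close> may be degenerate, so the usual quadratic in t is
  studied with a separate case for a null vector y.\<close>

lemma pos_op_Cauchy_Schwarz:
  fixes A :: "'a::complex_inner \<Rightarrow> 'a"
  assumes A: "linear_op A" "pos_op A"
  shows "(cmod (cinner x (A y)))\<^sup>2 \<le> Re (cinner x (A x)) * Re (cinner y (A y))"
proof -
  define a b z where "a = Re (cinner x (A x))" and "b = Re (cinner y (A y))" and "z = cinner x (A y)"
  have real: "cinner u (A u) = complex_of_real (Re (cinner u (A u)))" for u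
    using A(2) by (simp add: pos_op_def complex_eq_iff)
  have zc: "cinner y (A x) = cnj z"
    unfolding z_def by (metis cinner_commute pos_op_hermitian[OF A])
  have ab: "0 \<le> a" "0 \<le> b"
    using A(2) by (auto simp: pos_op_def a_def b_def)
  have key: "0 \<le> a - 2 * t * (cmod z)\<^sup>2 + t\<^sup>2 * (cmod z)\<^sup>2 * b" for t :: real
  proof -
    define c where "c = complex_of_real t * cnj z"
    have "cinner (x - scaleC c y) (A (x - scaleC c y))
        = complex_of_real a - c * z - cnj c * cnj z + cnj c * c * complex_of_real b"
      using real[of x] real[of y] unfolding a_def b_def
      by (simp add: linear_op_diff[OF A(1)] linear_op_scaleC[OF A(1)] cinner_simps zc
          z_def[symmetric] algebra_simps)
    also have "\<dots> = complex_of_real (a - 2 * t * (cmod z)\<^sup>2 + t\<^sup>2 * (cmod z)\<^sup>2 * b)"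
      unfolding c_def complex_norm_square[symmetric] of_real_diff of_real_add of_real_mult
      using complex_norm_square[of z] by (simp add: algebra_simps power2_eq_square)
    finally have "Re (cinner (x - scaleC c y) (A (x - scaleC c y)))
        = a - 2 * t * (cmod z)\<^sup>2 + t\<^sup>2 * (cmod z)\<^sup>2 * b"
      by (simp only: Re_complex_of_real)
    then show ?thesis
      using A(2) unfolding pos_op_def by metis
  qed
  show ?thesis
  proof (cases "b = 0")
    case True
    have "cmod z = 0"
    proof (rule ccontr)
      assume "cmod z \<noteq> 0"
      then show False
        \<comment> \<open>With b = 0 the bound is linear in t; this t makes it a - 2 (a + 1), which
          is negative.\<close>
        using key[of "(a + 1) / (cmod z)\<^sup>2"] ab True by simp
    qed
    then show ?thesis
      using ab by (simp add: z_def a_def b_def)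
  next
    case False
    then have "b > 0"
      using ab by simp
    then have "0 \<le> a - (cmod z)\<^sup>2 / b"
      using key[of "1 / b"] by (simp add: field_simps power2_eq_square)
    then show ?thesis
      using \<open>b > 0\<close> by (simp add: field_simps a_def b_def z_def)
  qed
qed

lemma linear_op_id: "linear_op (\<lambda>x. x)"
  by (simp add: linear_op_def)

lemma pos_op_id: "pos_op (\<lambda>x. x)"
  by (simp add: pos_op_def cinner_nonneg)

lemma cinner_Cauchy_Schwarz:
  "(cmod (cinner x (y::'a::complex_inner)))\<^sup>2 \<le> Re (cinner x x) * Re (cinner y y)"
  using pos_op_Cauchy_Schwarz[OF linear_op_id pos_op_id, of x y] by simp

lemma pos_op_eq_zero:
  fixes A :: "'a::complex_inner \<Rightarrow> 'a"
  assumes "linear_op A" "pos_op A" "Re (cinner x (A x)) \<le> 0"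
  shows "A x = 0"
proof -
  have "(cmod (cinner (A x) (A x)))\<^sup>2 \<le> 0"
    using pos_op_Cauchy_Schwarz[OF assms(1,2), of "A x" x] assms(2,3)
    by (metis antisym mult_zero_right pos_op_def)
  then show ?thesis
    by (simp add: cinner_eq_zero_iff)
qed

lemma bounded_op_norm_bound:
  fixes A :: "'a::complex_inner \<Rightarrow> 'a"
  assumes "bounded_op A"
  obtains C where "0 \<le> C" "\<And>x. Re (cinner (A x) (A x)) \<le> C * Re (cinner x x)"
proof -
  obtain C where C: "\<And>x. cnorm (A x) \<le> C * cnorm x"
    using assms by (auto simp: bounded_op_def)
  have "Re (cinner (A x) (A x)) \<le> C\<^sup>2 * Re (cinner x x)" for x
  proof -
    have "(cnorm (A x))\<^sup>2 \<le> (C * cnorm x)\<^sup>2"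
      using C[of x] by (intro power_mono) (auto simp: cnorm_def cinner_nonneg)
    then show ?thesis
      by (simp add: cnorm_def cinner_nonneg power_mult_distrib)
  qed
  then show thesis
    by (intro that[of "C\<^sup>2"]) auto
qed

text \<open>Expanding the square norm of x - A x, which is nonnegative, bounds the form by the two
  square norms without taking roots.\<close>

lemma bounded_op_form_bound:
  fixes A :: "'a::complex_inner \<Rightarrow> 'a"
  assumes "bounded_op A"
  obtains C where "0 \<le> C" "\<And>x. Re (cinner x (A x)) \<le> C * Re (cinner x x)"
proof -
  obtain C where C: "0 \<le> C" "\<And>x. Re (cinner (A x) (A x)) \<le> C * Re (cinner x x)"
    using bounded_op_norm_bound[OF assms] by blast
  have "Re (cinner x (A x)) \<le> (1 + C) * Re (cinner x x)" for x
  proof -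
    have "0 \<le> Re (cinner (x - A x) (x - A x))"
      by (rule cinner_nonneg)
    moreover have "Re (cinner (A x) x) = Re (cinner x (A x))"
      using cinner_commute[of "A x" x] by simp
    ultimately have "2 * Re (cinner x (A x)) \<le> Re (cinner x x) + Re (cinner (A x) (A x))"
      by (simp add: cinner_simps)
    also have "\<dots> \<le> (1 + C) * Re (cinner x x)"
      using C(2)[of x] by (simp add: algebra_simps)
    also have "\<dots> \<le> 2 * ((1 + C) * Re (cinner x x))"
      using C(1) cinner_nonneg[of x] by simp
    finally show ?thesis by simp
  qed
  then show thesis
    using C(1) by (intro that[of "1 + C"]) auto
qed

section \<open>Orthonormal bases, Bessel's inequality and Parseval's identity\<close>

definition orthonormal_set :: "'a::complex_inner set \<Rightarrow> bool" where
  "orthonormal_set B \<longleftrightarrow> (\<forall>x\<in>B. cinner x x = 1) \<and> (\<forall>x\<in>B. \<forall>y\<in>B. x \<noteq> y \<longrightarrow> cinner x y = 0)"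

lemma onb_orthonormal: "onb B \<Longrightarrow> orthonormal_set B"
  by (simp add: onb_def orthonormal_set_def)

lemma onb_exists: "\<exists>B :: 'a::complex_inner set. onb B"
proof -
  have "\<exists>M\<in>Collect orthonormal_set. \<forall>X\<in>Collect orthonormal_set. M \<subseteq> X \<longrightarrow> X = (M :: 'a set)"
  proof (rule subset_Zorn')
    fix \<C> :: "'a set set"
    assume chain: "subset.chain (Collect orthonormal_set) \<C>"
    have "cinner x x = 1" if "x \<in> \<Union>\<C>" for x
      using that chain by (auto simp: subset_chain_def orthonormal_set_def)
    moreover have "cinner x y = 0" if xy: "x \<in> \<Union>\<C>" "y \<in> \<Union>\<C>" "x \<noteq> y" for x y
    proof -
      obtain X Y where XY: "X \<in> \<C>" "x \<in> X" "Y \<in> \<C>" "y \<in> Y"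
        using xy(1,2) by blast
      then have "X \<subseteq> Y \<or> Y \<subseteq> X"
        using chain by (auto simp: subset_chain_def)
      then obtain Z where "Z \<in> \<C>" "x \<in> Z" "y \<in> Z"
        using XY by blast
      then show ?thesis
        using chain xy(3) by (auto simp: subset_chain_def orthonormal_set_def)
    qed
    ultimately show "\<Union>\<C> \<in> Collect orthonormal_set"
      by (auto simp: orthonormal_set_def)
  qed
  then obtain B :: "'a set" where B: "orthonormal_set B"
    and max: "\<And>X. orthonormal_set X \<Longrightarrow> B \<subseteq> X \<Longrightarrow> X = B"
    by blast
  have "x = 0" if x: "\<forall>e\<in>B. cinner e x = 0" for x
  proof (rule ccontr)
    assume "x \<noteq> 0"
    define s where "s = sqrt (Re (cinner x x))"
    have "Re (cinner x x) \<noteq> 0"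
      using \<open>x \<noteq> 0\<close> by (metis cinner_eq_zero_iff cinner_self_real of_real_0)
    then have s: "s > 0" "s * s = Re (cinner x x)"
      using cinner_nonneg[of x] by (auto simp: s_def)
    define u where "u = scaleC (complex_of_real (1 / s)) x"
    have "cinner u u = complex_of_real (1 / s * (1 / s) * (s * s))"
      unfolding u_def s(2) of_real_mult cinner_self_real[of x, symmetric] by (simp add: cinner_simps)
    also have "\<dots> = 1"
      using s(1) by simp
    finally have uu: "cinner u u = 1" .
    have eu: "cinner e u = 0" "cinner u e = 0" if "e \<in> B" for e
      using x that cinner_commute[of x e] by (auto simp: u_def cinner_simps)
    \<comment> \<open>A nonzero vector orthogonal to B would, after normalisation, enlarge a maximal
      orthonormal set.\<close>
    have "orthonormal_set (insert u B)"
      using B uu eu by (auto simp: orthonormal_set_def)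
    then have "u \<in> B"
      using max by blast
    then show False
      using eu uu by fastforce
  qed
  then show ?thesis
    using B unfolding onb_def orthonormal_set_def by (intro exI[of _ B]) simp
qed

definition fourier_sum :: "'a::complex_inner set \<Rightarrow> 'a \<Rightarrow> 'a" where
  "fourier_sum F x = (\<Sum>e\<in>F. scaleC (cinner e x) e)"

lemma cinner_fourier_sum:
  assumes "orthonormal_set B" "F \<subseteq> B" "finite F" "e \<in> B"
  shows "cinner e (fourier_sum F x) = (if e \<in> F then cinner e x else 0)"
proof -
  have "cinner e (fourier_sum F x) = (\<Sum>f\<in>F. if f = e then cinner e x else 0)"
    unfolding fourier_sum_def cinner_sum_right cinner_scaleC_right
    using assms by (intro sum.cong refl) (auto simp: orthonormal_set_def)
  then show ?thesis
    using assms(3) by simp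
qed

lemma fourier_sum_diff_norm:
  assumes B: "orthonormal_set B" "F \<subseteq> B" "finite F"
  shows "cinner (x - fourier_sum F x) (x - fourier_sum F x)
     = cinner x x - complex_of_real (\<Sum>e\<in>F. (cmod (cinner e x))\<^sup>2)"
proof -
  let ?S = "fourier_sum F x"
  have "cinner z ?S = (\<Sum>e\<in>F. cinner e x * cinner z e)" for z
    by (simp add: fourier_sum_def cinner_sum_right cinner_simps)
  then have "cinner x ?S = (\<Sum>e\<in>F. cinner e x * cnj (cinner e x))"
    by (simp only: cinner_commute[symmetric])
  then have 1: "cinner x ?S = complex_of_real (\<Sum>e\<in>F. (cmod (cinner e x))\<^sup>2)"
    by (simp only: of_real_sum complex_norm_square)
  have "cinner ?S ?S = (\<Sum>e\<in>F. cinner e x * cinner ?S e)"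
    by (simp add: fourier_sum_def cinner_sum_right cinner_simps)
  also have "\<dots> = (\<Sum>e\<in>F. cinner e x * cnj (cinner e x))"
  proof (intro sum.cong refl)
    fix e assume "e \<in> F"
    then have "cinner e ?S = cinner e x"
      using cinner_fourier_sum[OF B, of e x] B(2) by auto
    then show "cinner e x * cinner ?S e = cinner e x * cnj (cinner e x)"
      by (metis cinner_commute)
  qed
  finally have 2: "cinner ?S ?S = complex_of_real (\<Sum>e\<in>F. (cmod (cinner e x))\<^sup>2)"
    by (simp only: of_real_sum complex_norm_square)
  have 3: "cinner ?S x = complex_of_real (\<Sum>e\<in>F. (cmod (cinner e x))\<^sup>2)"
    using 1 cinner_commute[of ?S x] by simp
  show ?thesis
    by (simp only: cinner_diff_left cinner_diff_right 1 2 3) simp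
qed

lemma Bessel_finite:
  assumes "orthonormal_set B" "F \<subseteq> B" "finite F"
  shows "(\<Sum>e\<in>F. (cmod (cinner e x))\<^sup>2) \<le> Re (cinner x x)"
  using cinner_nonneg[of "x - fourier_sum F x"] fourier_sum_diff_norm[OF assms, of x] by simp

text \<open>\<open>onb\<close> only says that nothing nonzero is orthogonal to B, and B may be
  uncountable; completeness of the space has to produce the approximation. Finite sets whose Bessel
  sums approach the supremum s yield a Cauchy sequence, and its limit must be x since the difference
  is orthogonal to all of B.\<close>

lemma fourier_sum_approx:
  fixes x :: "'a::chilbert"
  assumes B: "onb B" and "0 < \<epsilon>"
  obtains F where "finite F" "F \<subseteq> B"
    "Re (cinner (x - fourier_sum F x) (x - fourier_sum F x)) < \<epsilon>"
proof -
  note on = onb_orthonormal[OF B]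
  define g where "g F = (\<Sum>e\<in>F. (cmod (cinner e x))\<^sup>2)" for F
  define s where "s = (SUP F\<in>{F. finite F \<and> F \<subseteq> B}. g F)"
  have bdd: "bdd_above (g ` {F. finite F \<and> F \<subseteq> B})"
    using Bessel_finite[OF on, of _ x] by (auto simp: g_def bdd_above_def)
  have le_s: "g F \<le> s" if "finite F" "F \<subseteq> B" for F
    unfolding s_def using that bdd by (intro cSUP_upper) auto
  have "\<exists>F. finite F \<and> F \<subseteq> B \<and> s - 1 / real (Suc n) < g F" for n
  proof -
    have "s - 1 / real (Suc n) < s" by simp
    then show ?thesis
      unfolding s_def using bdd by (subst (asm) less_cSUP_iff) auto
  qed
  then obtain G where G: "\<And>n. finite (G n)" "\<And>n. G n \<subseteq> B" "\<And>n. s - 1 / real (Suc n) < g (G n)"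
    by metis
  \<comment> \<open>Unions make the sets increasing, so that the square norm of S n - S m is a
    difference of Bessel sums and hence at most the remaining gap to s.\<close>
  define H where "H n = (\<Union>i\<le>n. G i)" for n
  have H: "finite (H n)" "H n \<subseteq> B" for n
    using G by (auto simp: H_def)
  have H_mono: "H m \<subseteq> H n" if "m \<le> n" for m n
    using that by (force simp: H_def)
  have gH: "s - 1 / real (Suc n) < g (H n)" for n
  proof -
    have "g (G n) \<le> g (H n)"
      unfolding g_def using H by (intro sum_mono2) (auto simp: H_def)
    then show ?thesis using G(3)[of n] by simp
  qed
  define S where "S n = fourier_sum (H n) x" for n
  have diff: "Re (cinner (S n - S m) (S n - S m)) = g (H n) - g (H m)" if "m \<le> n" for m n
  proof -
    have cS: "cinner e (S n) = cinner e x" if "e \<in> H n" for e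
      using that H[of n] cinner_fourier_sum[OF on H(2)[of n] H(1)[of n], of e x] by (auto simp: S_def)
    \<comment> \<open>Thus S m is the projection of S n, and \<open>fourier_sum_diff_norm\<close>
      applied to S n measures their distance.\<close>
    have eq: "fourier_sum (H m) (S n) = S m"
      unfolding S_def[of m] fourier_sum_def
      using H_mono[OF that] cS by (intro sum.cong refl) (metis subsetD)
    have gm: "(\<Sum>e\<in>F. (cmod (cinner e (S n)))\<^sup>2) = g F" if "F \<subseteq> H n" for F
      unfolding g_def using that cS by (intro sum.cong refl) (metis subsetD)
    have "fourier_sum (H n) (S n) = S n"
      using cS by (subst (2) S_def) (simp add: fourier_sum_def)
    then have "cinner (S n) (S n) = complex_of_real (g (H n))"
      using fourier_sum_diff_norm[OF on H(2)[of n] H(1)[of n], of "S n"] gm[of "H n"] by simp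
    then show ?thesis
      using fourier_sum_diff_norm[OF on H(2)[of m] H(1)[of m], of "S n"] gm[OF H_mono[OF that]] eq by simp
  qed
  have Cauchy_S: "\<forall>e>0. \<exists>N. \<forall>m\<ge>N. \<forall>n\<ge>N. sqrt (Re (cinner (S m - S n) (S m - S n))) < e"
  proof (intro allI impI)
    fix e :: real assume "e > 0"
    obtain N where N: "1 / real (Suc N) < e\<^sup>2"
      using \<open>e > 0\<close> by (metis nat_approx_posE zero_less_power)
    have aux: "Re (cinner (S m - S n) (S m - S n)) < e\<^sup>2" if "N \<le> n" "n \<le> m" for m n
    proof -
      have "1 / real (Suc n) \<le> 1 / real (Suc N)"
        using that(1) by (simp add: frac_le)
      then show ?thesis
        using diff[OF that(2)] gH[of n] le_s[OF H, of m] N by linarith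
    qed
    have sym: "cinner (S m - S n) (S m - S n) = cinner (S n - S m) (S n - S m)" for m n
      by (simp add: cinner_simps algebra_simps)
    have "sqrt (Re (cinner (S m - S n) (S m - S n))) < e" if "N \<le> m" "N \<le> n" for m n
    proof -
      have "Re (cinner (S m - S n) (S m - S n)) < e\<^sup>2"
        using aux[of n m] aux[of m n] that sym[of m n] by (cases "n \<le> m") auto
      then show ?thesis
        using \<open>e > 0\<close> by (metis real_sqrt_less_mono real_sqrt_unique less_imp_le)
    qed
    then show "\<exists>N. \<forall>m\<ge>N. \<forall>n\<ge>N. sqrt (Re (cinner (S m - S n) (S m - S n))) < e"
      by blast
  qed
  obtain L where L: "(\<lambda>n. sqrt (Re (cinner (S n - L) (S n - L)))) \<longlonglongrightarrow> 0"
    using cauchy_converges[OF Cauchy_S] by blast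
  have "cinner e (x - L) = 0" if e: "e \<in> B" for e
  proof -
    have ee: "cinner e e = 1"
      using e on by (simp add: orthonormal_set_def)
    have small: "(cmod (cinner e (S n - x)))\<^sup>2 \<le> 1 / real (Suc n)" for n
    proof (cases "e \<in> H n")
      case True
      then show ?thesis
        by (simp add: cinner_simps S_def cinner_fourier_sum[OF on H(2,1) e])
    next
      case False
      \<comment> \<open>A basis vector outside H n could be added to it, and the Bessel sum may grow
        by no more than the gap to s.\<close>
      have "(cmod (cinner e x))\<^sup>2 + g (H n) = g (insert e (H n))"
        using False H by (simp add: g_def)
      also have "\<dots> \<le> s"
        using H e by (intro le_s) auto
      finally show ?thesis
        using False gH[of n] by (simp add: cinner_simps S_def cinner_fourier_sum[OF on H(2,1) e])
    qed
    have "cmod (cinner e (S n - x)) \<le> sqrt (1 / real (Suc n))" for n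
      using small[of n] by (rule real_le_rsqrt)
    then have cm: "\<forall>\<^sub>F n in sequentially. norm (cinner e (S n - x)) \<le> sqrt (1 / real (Suc n))"
      by (intro always_eventually) simp
    have "(\<lambda>n. sqrt (1 / real (Suc n))) \<longlonglongrightarrow> sqrt 0"
      using tendsto_real_sqrt[OF LIMSEQ_Suc[OF lim_1_over_n]] by simp
    then have 1: "(\<lambda>n. cinner e (S n - x)) \<longlonglongrightarrow> 0"
      by (intro Lim_null_comparison[OF cm]) simp
    have "cmod (cinner e (S n - L)) \<le> sqrt (Re (cinner (S n - L) (S n - L)))" for n
      using cinner_Cauchy_Schwarz[of e "S n - L"] ee by (intro real_le_rsqrt) simp
    then have "\<forall>\<^sub>F n in sequentially. norm (cinner e (S n - L)) \<le> sqrt (Re (cinner (S n - L) (S n - L)))"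
      by (intro always_eventually allI)
    then have 2: "(\<lambda>n. cinner e (S n - L)) \<longlonglongrightarrow> 0"
      by (rule Lim_null_comparison[OF _ L])
    have "(\<lambda>n. cinner e (S n - L) - cinner e (S n - x)) \<longlonglongrightarrow> 0 - 0"
      by (intro tendsto_diff 1 2)
    then show ?thesis
      by (simp add: cinner_simps LIMSEQ_const_iff)
  qed
  then have "x - L = 0"
    using B unfolding onb_def by blast
  then have "x = L"
    by simp
  have "(\<lambda>n. (sqrt (Re (cinner (S n - L) (S n - L))))\<^sup>2) \<longlonglongrightarrow> 0\<^sup>2"
    by (intro tendsto_power L)
  then have "(\<lambda>n. Re (cinner (S n - L) (S n - L))) \<longlonglongrightarrow> 0"
    by (simp add: cinner_nonneg)
  then have "\<forall>\<^sub>F n in sequentially. Re (cinner (S n - L) (S n - L)) < \<epsilon>"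
    using \<open>0 < \<epsilon>\<close> by (rule order_tendstoD)
  then obtain n where n: "Re (cinner (S n - L) (S n - L)) < \<epsilon>"
    by (auto simp: eventually_sequentially)
  moreover have "cinner (x - S n) (x - S n) = cinner (S n - L) (S n - L)"
    unfolding \<open>x = L\<close> by (simp add: cinner_simps algebra_simps)
  ultimately show thesis
    using that[OF H, of n] by (simp add: S_def)
qed

lemma Parseval_norm:
  fixes x :: "'a::chilbert"
  assumes B: "onb B"
  shows "((\<lambda>e. (cmod (cinner e x))\<^sup>2) has_sum Re (cinner x x)) B"
proof -
  note on = onb_orthonormal[OF B]
  show ?thesis
    unfolding has_sum_def
  proof (rule tendstoI)
    fix \<epsilon> :: real assume "\<epsilon> > 0"
    obtain F where F: "finite F" "F \<subseteq> B"
      "Re (cinner (x - fourier_sum F x) (x - fourier_sum F x)) < \<epsilon>"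
      using fourier_sum_approx[OF B \<open>\<epsilon> > 0\<close>] by blast
    show "\<forall>\<^sub>F G in finite_subsets_at_top B. dist (\<Sum>e\<in>G. (cmod (cinner e x))\<^sup>2) (Re (cinner x x)) < \<epsilon>"
      unfolding eventually_finite_subsets_at_top
    proof (intro exI[of _ F] conjI allI impI F)
      fix G assume G: "finite G \<and> F \<subseteq> G \<and> G \<subseteq> B"
      have "(\<Sum>e\<in>F. (cmod (cinner e x))\<^sup>2) \<le> (\<Sum>e\<in>G. (cmod (cinner e x))\<^sup>2)"
        using G by (intro sum_mono2) auto
      then show "dist (\<Sum>e\<in>G. (cmod (cinner e x))\<^sup>2) (Re (cinner x x)) < \<epsilon>"
        using Bessel_finite[OF on, of G x] G F(3) fourier_sum_diff_norm[OF on F(2,1), of x]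
        by (simp add: dist_real_def)
    qed
  qed
qed

text \<open>Polarisation of the norm version over the four vectors y + c x with c = 1, -1, i,
  -i.\<close>

lemma Parseval:
  fixes x y :: "'a::chilbert"
  assumes B: "onb B"
  shows "((\<lambda>e. cinner x e * cinner e y) has_sum cinner x y) B"
proof -
  define N where "N c z = complex_of_real ((cmod (cinner z (y + scaleC c x)))\<^sup>2)" for c z
  have polar: "4 * (cnj u * v) = complex_of_real ((cmod (v + u))\<^sup>2) - complex_of_real ((cmod (v - u))\<^sup>2)
      + \<i> * complex_of_real ((cmod (v + \<i> * u))\<^sup>2) - \<i> * complex_of_real ((cmod (v - \<i> * u))\<^sup>2)"
    for u v :: complex
    unfolding complex_norm_square by (simp add: algebra_simps)
  have has: "((\<lambda>e. N c e) has_sum cinner (y + scaleC c x) (y + scaleC c x)) B" for c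
    unfolding N_def by (subst cinner_self_real) (rule has_sum_of_real[OF Parseval_norm[OF B]])
  have "((\<lambda>e. N 1 e + - N (-1) e + \<i> * N \<i> e + - (\<i> * N (-\<i>) e)) has_sum
      cinner (y + scaleC 1 x) (y + scaleC 1 x) + - cinner (y + scaleC (-1) x) (y + scaleC (-1) x)
      + \<i> * cinner (y + scaleC \<i> x) (y + scaleC \<i> x)
      + - (\<i> * cinner (y + scaleC (-\<i>) x) (y + scaleC (-\<i>) x))) B"
    by (intro has_sum_add has_sum_uminusI has_sum_cmult_right has)
  moreover have "N 1 e + - N (-1) e + \<i> * N \<i> e + - (\<i> * N (-\<i>) e) = 4 * (cinner x e * cinner e y)" for e
    using polar[of "cinner e x" "cinner e y"] by (simp add: N_def cinner_simps cinner_commute[symmetric])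
  moreover have "cinner (y + scaleC 1 x) (y + scaleC 1 x) + - cinner (y + scaleC (-1) x) (y + scaleC (-1) x)
      + \<i> * cinner (y + scaleC \<i> x) (y + scaleC \<i> x)
      + - (\<i> * cinner (y + scaleC (-\<i>) x) (y + scaleC (-\<i>) x)) = 4 * cinner x y"
    by (simp add: cinner_simps algebra_simps)
  ultimately have "((\<lambda>e. 4 * (cinner x e * cinner e y)) has_sum 4 * cinner x y) B"
    by simp
  from has_sum_cmult_right[OF this, of "1/4"] show ?thesis
    by simp
qed

section \<open>Rank-one expansion of positive trace-class operators\<close>

lemma scaleC_diff_right: "scaleC c (x - y) = scaleC c x - scaleC c (y::'a::complex_inner)"
  using scaleC_add_right[of c "x - y" y] by simp

lemma scaleC_zero_right: "scaleC c (0::'a::complex_inner) = 0"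
  using scaleC_add_right[of c 0 "0::'a"] by simp

text \<open>One elimination step (a Schur complement): A minus the rank-one operator
  \<open>|A e><A e| / <e, A e>\<close>, which is \<open>|v><v|\<close> for v =
  \<open>deflate_vec A e\<close>. If the pivot \<open><e, A e>\<close> is 0, division by zero gives
  0 and A is left as it is; for positive A this is right, since then A e = 0.\<close>

definition deflate :: "('a::complex_inner \<Rightarrow> 'a) \<Rightarrow> 'a \<Rightarrow> 'a \<Rightarrow> 'a" where
  "deflate A e x = A x - scaleC (cinner e (A x) / cinner e (A e)) (A e)"

definition deflate_vec :: "('a::complex_inner \<Rightarrow> 'a) \<Rightarrow> 'a \<Rightarrow> 'a" where
  "deflate_vec A e = scaleC (complex_of_real (1 / sqrt (Re (cinner e (A e))))) (A e)"

lemma deflate_linear: "linear_op A \<Longrightarrow> linear_op (deflate A e)"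
  unfolding linear_op_def deflate_def
  by (simp add: cinner_simps add_divide_distrib scaleC_add_left scaleC_diff_right scaleC_scaleC)

lemma cinner_deflate:
  fixes A :: "'a::complex_inner \<Rightarrow> 'a"
  assumes A: "linear_op A" "pos_op A"
  shows "cinner x (deflate A e y)
    = cinner x (A y) - cinner x (deflate_vec A e) * cinner (deflate_vec A e) y"
proof -
  define a where "a = Re (cinner e (A e))"
  have a: "0 \<le> a" "cinner e (A e) = complex_of_real a"
    using A(2) by (auto simp: a_def pos_op_def complex_eq_iff)
  have "complex_of_real (sqrt a) * complex_of_real (sqrt a) = complex_of_real a"
    using a(1) by (simp flip: of_real_mult)
  then show ?thesis
    unfolding deflate_def deflate_vec_def a_def[symmetric] a(2)
    by (simp add: cinner_simps pos_op_hermitian[OF A, symmetric])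
qed

text \<open>The subtracted form is \<open>|<x, A e>|^2 / <e, A e>\<close>, which Cauchy-Schwarz for
  the form of A bounds by \<open><x, A x>\<close>.\<close>

lemma deflate_pos:
  fixes A :: "'a::complex_inner \<Rightarrow> 'a"
  assumes A: "linear_op A" "pos_op A"
  shows "pos_op (deflate A e)"
  unfolding pos_op_def
proof
  fix x
  define a where "a = Re (cinner e (A e))"
  have a: "0 \<le> a" "cinner e (A e) = complex_of_real a"
    using A(2) by (auto simp: a_def pos_op_def complex_eq_iff)
  let ?v = "deflate_vec A e"
  have "cinner x ?v * cinner ?v x = complex_of_real ((cmod (cinner x ?v))\<^sup>2)"
    using cinner_commute[of ?v x] by (simp only: complex_norm_square)
  then have eq: "cinner x (deflate A e x) = cinner x (A x) - complex_of_real ((cmod (cinner x ?v))\<^sup>2)"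
    by (simp only: cinner_deflate[OF A])
  have "(cmod (cinner x ?v))\<^sup>2 = (cmod (cinner x (A e)))\<^sup>2 / a"
    using a(1) by (simp add: deflate_vec_def a_def[symmetric] cinner_simps norm_mult norm_divide
        power_divide)
  also have "\<dots> \<le> Re (cinner x (A x))"
    using pos_op_Cauchy_Schwarz[OF A, of x e] a(1) A(2)
    by (cases "a = 0") (auto simp: a_def[symmetric] pos_op_def divide_simps)
  finally show "Im (cinner x (deflate A e x)) = 0 \<and> 0 \<le> Re (cinner x (deflate A e x))"
    using A(2) unfolding eq by (simp add: pos_op_def)
qed

lemma deflate_self:
  fixes A :: "'a::complex_inner \<Rightarrow> 'a"
  assumes A: "linear_op A" "pos_op A"
  shows "deflate A e e = 0"
proof (cases "cinner e (A e) = 0")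
  case True
  then have "A e = 0"
    using pos_op_eq_zero[OF A] by simp
  then show ?thesis
    by (simp add: deflate_def scaleC_zero_right)
qed (simp add: deflate_def scaleC_one)

text \<open>Cholesky elimination does the work of a square root of the positive operator.\<close>

fun cholesky_rem :: "('a::complex_inner \<Rightarrow> 'a) \<Rightarrow> (nat \<Rightarrow> 'a) \<Rightarrow> nat \<Rightarrow> 'a \<Rightarrow> 'a" where
  "cholesky_rem r e 0 = r"
| "cholesky_rem r e (Suc n) = deflate (cholesky_rem r e n) (e n)"

lemma cholesky_rem_linear_pos:
  assumes "linear_op r" "pos_op r"
  shows "linear_op (cholesky_rem r e n) \<and> pos_op (cholesky_rem r e n)"
  by (induction n) (auto simp: assms deflate_linear deflate_pos)

text \<open>Elimination along an enumeration of the basis vectors that r sees. The quadratic forms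
  of the remainders decrease, so a vector once killed stays killed; each basis vector is killed
  eventually, and boundedness of r carries the decay from finite linear combinations to all
  vectors.\<close>

lemma pos_op_rank_one_expansion:
  fixes r :: "'a::chilbert \<Rightarrow> 'a"
  assumes B: "onb B" and r: "bounded_op r" "pos_op r"
    and summ: "(\<lambda>b. cinner b (r b)) summable_on B"
  obtains v :: "nat \<Rightarrow> 'a" where "\<And>x y. (\<lambda>k. cinner x (v k) * cinner (v k) y) sums cinner x (r y)"
proof -
  define Z where "Z = {b\<in>B. cinner b (r b) \<noteq> 0}"
  \<comment> \<open>A summable family has only countably many nonzero terms; this makes elimination
    by a sequence possible even if B is uncountable.\<close>
  have "countable Z"
    unfolding Z_def using summ
    by (intro abs_summable_countable) (simp flip: summable_on_iff_abs_summable_on_complex)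
  \<comment> \<open>Adding 0 keeps the enumerated set nonempty, and deflating at the vector 0
    changes nothing.\<close>
  define e where "e = from_nat_into (insert 0 Z)"
  have range_e: "range e = insert 0 Z"
    unfolding e_def using \<open>countable Z\<close> by (intro range_from_nat_into) auto
  define R where "R = cholesky_rem r e"
  define v where "v n = deflate_vec (R n) (e n)" for n
  have R: "linear_op (R n)" "pos_op (R n)" for n
    using cholesky_rem_linear_pos[OF bounded_op_linear[OF r(1)] r(2)] by (auto simp: R_def)
  have R0: "R 0 = r" and RSuc: "R (Suc n) = deflate (R n) (e n)" for n
    by (auto simp: R_def)
  define q where "q n x = Re (cinner x (R n x))" for n x
  have q_nonneg: "0 \<le> q n x" for n x
    using R(2) by (simp add: q_def pos_op_def)
  have q_Suc: "q (Suc n) x \<le> q n x" for n x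
  proof -
    have "cinner x (v n) * cinner (v n) x = complex_of_real ((cmod (cinner x (v n)))\<^sup>2)"
      using cinner_commute[of "v n" x] by (simp only: complex_norm_square)
    then have "Re (cinner x (v n) * cinner (v n) x) = (cmod (cinner x (v n)))\<^sup>2"
      by (simp only: Re_complex_of_real)
    then show ?thesis
      by (simp only: q_def RSuc cinner_deflate[OF R] v_def[symmetric] minus_complex.simps) simp
  qed
  have q_mono: "q n x \<le> q m x" if "m \<le> n" for m n x
    using q_Suc that by (rule lift_Suc_antimono_le)
  have vanish: "\<exists>N. \<forall>n\<ge>N. R n b = 0" if "b \<in> B" for b
  proof -
    have "\<exists>N. q N b \<le> 0"
    proof (cases "b \<in> Z")
      case True
      then obtain N where "b = e N"
        using range_e by (metis insertI2 rangeE)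
      then have "q (Suc N) b \<le> 0"
        by (simp add: q_def RSuc deflate_self[OF R])
      then show ?thesis ..
    next
      case False
      then have "q 0 b \<le> 0"
        using that by (simp add: Z_def q_def R0)
      then show ?thesis ..
    qed
    then obtain N where N: "q N b \<le> 0" ..
    have "R n b = 0" if "N \<le> n" for n
      using pos_op_eq_zero[OF R, of b n] q_mono[OF that, of b] N by (simp add: q_def)
    then show ?thesis by blast
  qed
  obtain C where C: "0 \<le> C" "\<And>x. Re (cinner x (r x)) \<le> C * Re (cinner x x)"
    using bounded_op_form_bound[OF r(1)] by blast
  have q_lim: "(\<lambda>n. q n x) \<longlonglongrightarrow> 0" for x
  proof (rule LIMSEQ_I)
    fix \<epsilon> :: real assume "\<epsilon> > 0"
    \<comment> \<open>C + 1 instead of C keeps the denominator positive when C = 0.\<close>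
    have "0 < \<epsilon> / (2 * (C + 1))"
      using \<open>\<epsilon> > 0\<close> C(1) by simp
    then obtain F where F: "finite F" "F \<subseteq> B"
      and small: "Re (cinner (x - fourier_sum F x) (x - fourier_sum F x)) < \<epsilon> / (2 * (C + 1))"
      by (rule fourier_sum_approx[OF B])
    define s where "s = fourier_sum F x"
    have "\<forall>\<^sub>F n in sequentially. \<forall>b\<in>F. R n b = 0"
      using vanish F by (intro eventually_ball_finite) (auto simp: eventually_sequentially)
    then obtain N where N: "\<And>b n. b \<in> F \<Longrightarrow> N \<le> n \<Longrightarrow> R n b = 0"
      by (auto simp: eventually_sequentially)
    have "norm (q n x - 0) < \<epsilon>" if "N \<le> n" for n
    proof -
      have Rs: "R n s = 0"
        unfolding s_def fourier_sum_def linear_op_sum[OF R(1)] linear_op_scaleC[OF R(1)]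
        using N that by (intro sum.neutral) (simp add: scaleC_zero_right)
      have "cinner s (R n x) = 0"
        using pos_op_hermitian[OF R, of s n x] Rs by simp
      \<comment> \<open>For large n the remainder kills s, so s can be subtracted for free; only
        afterwards is the form enlarged to that of r, where x - s is small.\<close>
      then have "q n x = q n (x - s)"
        using Rs by (simp add: q_def linear_op_diff[OF R(1)] cinner_simps)
      also have "\<dots> \<le> q 0 (x - s)"
        by (rule q_mono) simp
      also have "\<dots> \<le> C * Re (cinner (x - s) (x - s))"
        unfolding q_def R0 by (rule C(2))
      also have "\<dots> \<le> (C + 1) * Re (cinner (x - s) (x - s))"
        using cinner_nonneg[of "x - s"] by (simp add: algebra_simps)
      also have "\<dots> \<le> (C + 1) * (\<epsilon> / (2 * (C + 1)))"
        using small C(1) by (intro mult_left_mono) (auto simp: s_def)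
      also have "\<dots> = \<epsilon> / 2"
        using C(1) by (simp add: divide_simps)
      also have "\<dots> < \<epsilon>"
        using \<open>\<epsilon> > 0\<close> by simp
      finally show ?thesis
        using q_nonneg[of n x] by simp
    qed
    then show "\<exists>N. \<forall>n\<ge>N. norm (q n x - 0) < \<epsilon>" by blast
  qed
  \<comment> \<open>Cauchy-Schwarz for the remainder itself passes from its quadratic form to its
    matrix elements.\<close>
  have R_lim: "(\<lambda>n. cinner x (R n y)) \<longlonglongrightarrow> 0" for x y
  proof (rule Lim_null_comparison)
    show "\<forall>\<^sub>F n in sequentially. norm (cinner x (R n y)) \<le> sqrt (q n x * q 0 y)"
    proof (intro always_eventually allI real_le_rsqrt)
      fix n
      have "(cmod (cinner x (R n y)))\<^sup>2 \<le> q n x * q n y"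
        using pos_op_Cauchy_Schwarz[OF R] by (simp add: q_def)
      also have "\<dots> \<le> q n x * q 0 y"
        using q_nonneg q_mono by (intro mult_left_mono) auto
      finally show "(cmod (cinner x (R n y)))\<^sup>2 \<le> q n x * q 0 y" .
    qed
    have "(\<lambda>n. sqrt (q n x * q 0 y)) \<longlonglongrightarrow> sqrt (0 * q 0 y)"
      by (intro tendsto_intros q_lim)
    then show "(\<lambda>n. sqrt (q n x * q 0 y)) \<longlonglongrightarrow> 0" by simp
  qed
  have partial: "(\<Sum>k<n. cinner x (v k) * cinner (v k) y) = cinner x (r y) - cinner x (R n y)" for n x y
    by (induction n) (auto simp: R0 RSuc cinner_deflate[OF R] v_def)
  have "(\<lambda>k. cinner x (v k) * cinner (v k) y) sums cinner x (r y)" for x y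
  proof -
    have "(\<lambda>n. cinner x (r y) - cinner x (R n y)) \<longlonglongrightarrow> cinner x (r y) - 0"
      by (intro tendsto_intros R_lim)
    then show ?thesis
      unfolding sums_def partial by simp
  qed
  then show thesis by (rule that)
qed

text \<open>Fubini for the double family \<open><A v_k, b> <b, v_k>\<close>: summing over b first
  gives \<open><v_k, A v_k>\<close> by Parseval, summing over k first gives
  \<open><b, r A b>\<close> by the expansion of r. One sequence v serves all A.\<close>

lemma trace_rank_one_expansion:
  fixes r :: "'a::chilbert \<Rightarrow> 'a"
  assumes B: "onb B" and r: "bounded_op r" "pos_op r"
    and summ: "(\<lambda>b. cinner b (r b)) summable_on B"
  obtains v :: "nat \<Rightarrow> 'a"
  where "\<And>A. bounded_op A \<Longrightarrow> pos_op A \<Longrightarrow>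
     \<exists>t. ((\<lambda>b. cinner b (r (A b))) has_sum t) B \<and> ((\<lambda>k. cinner (v k) (A (v k))) has_sum t) UNIV"
proof -
  obtain v where v: "\<And>x y. (\<lambda>k. cinner x (v k) * cinner (v k) y) sums cinner x (r y)"
    using pos_op_rank_one_expansion[OF assms] by metis
  have S1: "((\<lambda>k. (cmod (cinner b (v k)))\<^sup>2) has_sum Re (cinner b (r b))) UNIV" for b
  proof -
    have "cinner b (v k) * cinner (v k) b = complex_of_real ((cmod (cinner b (v k)))\<^sup>2)" for k
      using cinner_commute[of "v k" b] by (simp only: complex_norm_square)
    then have "(\<lambda>k. (cmod (cinner b (v k)))\<^sup>2) sums Re (cinner b (r b))"
      using sums_Re[OF v[of b b]] by (simp only: Re_complex_of_real)
    then show ?thesis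
      by (intro norm_summable_imp_has_sum) (auto simp: sums_iff)
  qed
  have "(\<lambda>(b, k). (cmod (cinner b (v k)))\<^sup>2) summable_on B \<times> UNIV"
    using S1 summable_on_Re[OF summ] by (intro summable_on_SigmaI[where g="\<lambda>b. Re (cinner b (r b))"]) auto
  then have S2: "(\<lambda>(k, b). (cmod (cinner b (v k)))\<^sup>2) summable_on UNIV \<times> B"
    by (subst summable_on_swap) (simp add: case_prod_unfold)
  \<comment> \<open>The square norms of the v_k are summable because, in the other order of
    summation, they add up to the diagonal of r.\<close>
  have S3: "(\<lambda>k. Re (cinner (v k) (v k))) summable_on UNIV"
    using has_sum_SigmaD[OF has_sum_infsum[OF S2]] Parseval_norm[OF B]
    by (fastforce simp: summable_on_def)
  have "\<exists>t. ((\<lambda>b. cinner b (r (A b))) has_sum t) B \<and> ((\<lambda>k. cinner (v k) (A (v k))) has_sum t) UNIV"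
    if A: "bounded_op A" "pos_op A" for A
  proof -
    note herm = pos_op_hermitian[OF bounded_op_linear[OF A(1)] A(2)]
    obtain C where C: "0 \<le> C" "\<And>x. Re (cinner (A x) (A x)) \<le> C * Re (cinner x x)"
      using bounded_op_norm_bound[OF A(1)] by blast
    have "(\<lambda>k. Re (cinner (A (v k)) (A (v k)))) summable_on UNIV"
      by (rule summable_on_comparison_test[OF summable_on_cmult_right[OF S3, of C]])
        (auto simp: C cinner_nonneg)
    then have "(\<lambda>(k, b). (cmod (cinner b (A (v k))))\<^sup>2) summable_on UNIV \<times> B"
      using Parseval_norm[OF B]
      by (intro summable_on_SigmaI[where g="\<lambda>k. Re (cinner (A (v k)) (A (v k)))"]) auto
    from summable_on_add[OF this S2]
    have dom: "(\<lambda>(k, b). (cmod (cinner b (A (v k))))\<^sup>2 + (cmod (cinner b (v k)))\<^sup>2) summable_on UNIV \<times> B"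
      by (simp add: case_prod_unfold)
    define g where "g = (\<lambda>(k, b). cinner (A (v k)) b * cinner b (v k))"
    \<comment> \<open>A product of two numbers is dominated by the sum of their squares, and both
      families of squares are summable.\<close>
    have g_le: "norm (g p) \<le> (\<lambda>(k, b). (cmod (cinner b (A (v k))))\<^sup>2 + (cmod (cinner b (v k)))\<^sup>2) p" for p
    proof -
      have "norm (cinner (A (v k)) b * cinner b (v k)) \<le> (cmod (cinner b (A (v k))))\<^sup>2 + (cmod (cinner b (v k)))\<^sup>2"
        for k b
        using sum_squares_bound[of "cmod (cinner b (A (v k)))" "cmod (cinner b (v k))"]
          mult_nonneg_nonneg[OF norm_ge_zero[of "cinner b (A (v k))"] norm_ge_zero[of "cinner b (v k)"]]
        unfolding norm_mult cmod_cinner_commute[of "A (v k)" b] by linarith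
      then show ?thesis
        by (cases p) (simp add: g_def)
    qed
    have g: "g summable_on UNIV \<times> B"
      by (rule abs_summable_summable[OF Infinite_Sum.abs_summable_on_comparison_test'[OF dom g_le]])
    define t where "t = infsum g (UNIV \<times> B)"
    have t: "(g has_sum t) (UNIV \<times> B)"
      unfolding t_def using g by simp
    have 1: "((\<lambda>k. cinner (v k) (A (v k))) has_sum t) UNIV"
    proof (rule has_sum_SigmaD[OF t])
      fix k
      show "((\<lambda>b. g (k, b)) has_sum cinner (v k) (A (v k))) B"
        using Parseval[OF B, of "A (v k)" "v k"] by (simp add: g_def herm)
    qed
    have t': "((\<lambda>(b, k). g (k, b)) has_sum t) (B \<times> UNIV)"
      using t by (subst (asm) has_sum_swap)
    have 2: "((\<lambda>b. cinner b (r (A b))) has_sum t) B"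
    proof (rule has_sum_SigmaD[OF t'])
      fix b assume "b \<in> B"
      \<comment> \<open>The expansion of r converges only as an ordered series; unconditional
        summability comes from Fubini, and the ordered series then identifies the value.\<close>
      have "(\<lambda>k. g (k, b)) summable_on UNIV"
        using summable_on_SigmaD1[of "\<lambda>b k. g (k, b)" B "\<lambda>_. UNIV" b] t' \<open>b \<in> B\<close>
        by (auto simp: summable_on_def)
      then have s: "((\<lambda>k. g (k, b)) has_sum infsum (\<lambda>k. g (k, b)) UNIV) UNIV"
        by simp
      have "(\<lambda>k. g (k, b)) sums cinner b (r (A b))"
        using v[of b "A b"] by (simp add: g_def herm mult.commute)
      then have "infsum (\<lambda>k. g (k, b)) UNIV = cinner b (r (A b))"
        using has_sum_imp_sums[OF s] sums_unique2 by blast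
      then show "((\<lambda>k. (case (b, k) of (b, k) \<Rightarrow> g (k, b))) has_sum cinner b (r (A b))) UNIV"
        using s by simp
    qed
    show ?thesis using 1 2 by blast
  qed
  then show thesis by (rule that)
qed

section \<open>Outcome measures\<close>

lemma onb_some: "onb (SOME B :: 'a::complex_inner set. onb B)"
  using onb_exists by (rule someI_ex)

text \<open>For positive operators a summable diagonal in one basis amounts to being trace class.
  The basis is the very one that \<open>ctrace\<close> selects, so no change of basis is ever
  required.\<close>

definition pos_trace_class :: "('a::complex_inner \<Rightarrow> 'a) \<Rightarrow> bool" where
  "pos_trace_class r \<longleftrightarrow> bounded_op r \<and> pos_op r \<and> (\<lambda>b. cinner b (r b)) summable_on (SOME B. onb B)"

text \<open>An enumeration of F serves as both orthonormal families in the supremum.\<close>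

lemma sum_diagonal_le_trace_norm:
  fixes X :: "'a::complex_inner \<Rightarrow> 'a"
  assumes "orthonormal_set B" "F \<subseteq> B" "finite F"
  shows "ereal (\<Sum>b\<in>F. cmod (cinner b (X b))) \<le> trace_norm X"
proof -
  obtain e where e: "bij_betw e {0..<card F} F"
    using ex_bij_betw_nat_finite[OF assms(3)] by blast
  have "orthonormal_fam (card F) e"
    unfolding orthonormal_fam_def
  proof (intro allI impI)
    fix i j assume ij: "i < card F" "j < card F"
    then have "e i \<in> B" "e j \<in> B" "e i = e j \<longleftrightarrow> i = j"
      using e assms(2) by (auto simp: bij_betw_def inj_on_def)
    then show "cinner (e i) (e j) = (if i = j then 1 else 0)"
      using assms(1) by (auto simp: orthonormal_set_def)
  qed
  then have "ereal (\<Sum>i<card F. cmod (cinner (e i) (X (e i)))) \<le> trace_norm X"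
    unfolding trace_norm_def by (intro SUP_upper2[of "(card F, e, e)"]) auto
  moreover have "(\<Sum>i<card F. cmod (cinner (e i) (X (e i)))) = (\<Sum>b\<in>F. cmod (cinner b (X b)))"
    using sum.reindex_bij_betw[OF e, of "\<lambda>b. cmod (cinner b (X b))"] by (simp add: atLeast0LessThan)
  ultimately show ?thesis by simp
qed

lemma trace_class_diagonal:
  fixes X :: "'a::complex_inner \<Rightarrow> 'a"
  assumes "trace_class X"
  shows "(\<lambda>b. cinner b (X b)) summable_on (SOME B. onb B)" (is "_ summable_on ?B")
    and "ereal (Re (ctrace X)) \<le> trace_norm X"
proof -
  note on = onb_orthonormal[OF onb_some]
  have "0 \<le> trace_norm X"
    using sum_diagonal_le_trace_norm[OF on, of "{}" X] by (simp add: zero_ereal_def)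
  then obtain c where c: "trace_norm X = ereal c"
    using assms by (cases "trace_norm X") (auto simp: trace_class_def)
  have le: "(\<Sum>b\<in>F. cmod (cinner b (X b))) \<le> c" if "finite F" "F \<subseteq> ?B" for F
    using sum_diagonal_le_trace_norm[OF on that(2,1), of X] by (simp add: c)
  have abs: "(\<lambda>b. cmod (cinner b (X b))) summable_on ?B"
    using le by (intro nonneg_bdd_above_summable_on) (auto intro!: bdd_aboveI2)
  then show summ: "(\<lambda>b. cinner b (X b)) summable_on ?B"
    by (rule abs_summable_summable)
  have "Re (ctrace X) = (\<Sum>\<^sub>\<infinity>b\<in>?B. Re (cinner b (X b)))"
    unfolding ctrace_def by (rule infsum_Re[OF summ, symmetric])
  also have "\<dots> \<le> (\<Sum>\<^sub>\<infinity>b\<in>?B. cmod (cinner b (X b)))"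
    by (intro infsum_mono summable_on_Re summ abs complex_Re_le_cmod)
  also have "\<dots> \<le> c"
    by (rule infsum_le_finite_sums[OF abs le])
  finally show "ereal (Re (ctrace X)) \<le> trace_norm X"
    by (simp add: c)
qed

text \<open>The individual diagonal entries of r A need not be nonnegative or even real; positivity
  of the trace appears only after rewriting it as the sum of the
  \<open><v_k, A v_k>\<close>.\<close>

lemma pos_trace_class_product:
  fixes r :: "'a::chilbert \<Rightarrow> 'a"
  assumes "pos_trace_class r" "bounded_op A" "pos_op A"
  shows "(\<lambda>b. cinner b (r (A b))) summable_on (SOME B. onb B)"
    and "0 \<le> Re (ctrace (\<lambda>x. r (A x)))"
proof -
  obtain v :: "nat \<Rightarrow> 'a" where v: "\<And>A. bounded_op A \<Longrightarrow> pos_op A \<Longrightarrow>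
     \<exists>t. ((\<lambda>b. cinner b (r (A b))) has_sum t) (SOME B. onb B)
       \<and> ((\<lambda>k. cinner (v k) (A (v k))) has_sum t) UNIV"
    using trace_rank_one_expansion[OF onb_some, of r] assms(1) unfolding pos_trace_class_def by metis
  then obtain t where t: "((\<lambda>b. cinner b (r (A b))) has_sum t) (SOME B. onb B)"
      "((\<lambda>k. cinner (v k) (A (v k))) has_sum t) UNIV"
    using assms(2,3) by blast
  then show "(\<lambda>b. cinner b (r (A b))) summable_on (SOME B. onb B)"
    by (auto simp: summable_on_def)
  have "ctrace (\<lambda>x. r (A x)) = t"
    unfolding ctrace_def using t(1) by (rule infsumI)
  then show "0 \<le> Re (ctrace (\<lambda>x. r (A x)))"
    using has_sum_nonneg[OF has_sum_Re[OF t(2)]] assms(3) by (simp add: pos_op_def)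
qed

lemma PovmD:
  assumes "M \<in> Povm"
  shows "\<And>B. B \<in> sets borel \<Longrightarrow> bounded_op (M B)" "\<And>B. B \<in> sets borel \<Longrightarrow> pos_op (M B)"
    "\<And>Bs x y. range Bs \<subseteq> sets borel \<Longrightarrow> disjoint_family Bs \<Longrightarrow>
        (\<lambda>j. cinner x (M (Bs j) y)) sums cinner x (M (\<Union>j. Bs j) y)"
    "M UNIV = id" "\<And>B. B \<notin> sets borel \<Longrightarrow> M B = (\<lambda>_. 0)"
  using assms unfolding Povm_def by blast+

lemma sets_outcome_measure [simp, measurable_cong]: "sets (outcome_measure r M) = sets borel"
  unfolding outcome_measure_def by (simp add: sets.sigma_sets_eq[of borel, simplified])

lemma space_outcome_measure [simp]: "space (outcome_measure r M) = UNIV"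
  unfolding outcome_measure_def by simp

lemma suminf_ennreal_swap:
  fixes f :: "nat \<Rightarrow> nat \<Rightarrow> ennreal"
  shows "(\<Sum>i. \<Sum>k. f i k) = (\<Sum>k. \<Sum>i. f i k)"
  using nn_integral_suminf[of "\<lambda>k i. f i k" "count_space UNIV"]
  by (simp add: nn_integral_count_space_nat)

text \<open>This certifies that the set function handed to \<open>measure_of\<close> is a measure.
  Each \<open>m k\<close> is countably additive by weak additivity of M at v_k, and the two
  nonnegative series may be interchanged.\<close>

lemma emeasure_outcome_measure:
  fixes r :: "'a::chilbert \<Rightarrow> 'a" and M :: "'u::topological_space set \<Rightarrow> 'a \<Rightarrow> 'a"
  assumes r: "pos_trace_class r" and M: "M \<in> Povm" and B: "B \<in> sets borel"
  shows "emeasure (outcome_measure r M) B = ennreal (Re (ctrace (\<lambda>x. r (M B x))))"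
proof -
  obtain v :: "nat \<Rightarrow> 'a" where v: "\<And>A. bounded_op A \<Longrightarrow> pos_op A \<Longrightarrow>
     \<exists>t. ((\<lambda>b. cinner b (r (A b))) has_sum t) (SOME B. onb B)
       \<and> ((\<lambda>k. cinner (v k) (A (v k))) has_sum t) UNIV"
    using trace_rank_one_expansion[OF onb_some, of r] r unfolding pos_trace_class_def by metis
  define \<mu> where "\<mu> S = ennreal (Re (ctrace (\<lambda>x. r (M S x))))" for S
  define m where "m k S = Re (cinner (v k) (M S (v k)))" for k S
  have m_nonneg: "0 \<le> m k S" if "S \<in> sets borel" for k S
    using PovmD(2)[OF M that] by (simp add: m_def pos_op_def)
  have \<mu>: "\<mu> S = (\<Sum>k. ennreal (m k S))" if S: "S \<in> sets borel" for S
  proof -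
    obtain t where t: "((\<lambda>b. cinner b (r (M S b))) has_sum t) (SOME B. onb B)"
      "((\<lambda>k. cinner (v k) (M S (v k))) has_sum t) UNIV"
      using v[OF PovmD(1,2)[OF M S]] by blast
    have "ctrace (\<lambda>x. r (M S x)) = t"
      unfolding ctrace_def using t(1) by (rule infsumI)
    moreover have "(\<lambda>k. m k S) sums Re t"
      using has_sum_imp_sums[OF has_sum_Re[OF t(2)]] by (simp only: m_def)
    then have "(\<Sum>k. ennreal (m k S)) = ennreal (Re t)"
      by (rule suminf_ennreal_eq[OF m_nonneg[OF S]])
    ultimately show ?thesis
      by (simp only: \<mu>_def)
  qed
  have m_add: "(\<Sum>i. ennreal (m k (A i))) = ennreal (m k (\<Union>i. A i))"
    if A: "range A \<subseteq> sets borel" "disjoint_family A" for A :: "nat \<Rightarrow> 'u set" and k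
    using sums_Re[OF PovmD(3)[OF M A, of "v k" "v k"]] A(1)
    by (intro suminf_ennreal_eq m_nonneg) (auto simp: m_def)
  have ca: "countably_additive (sets borel) \<mu>"
  proof (rule countably_additiveI)
    fix A :: "nat \<Rightarrow> 'u set"
    assume A: "range A \<subseteq> sets borel" "disjoint_family A" "\<Union> (range A) \<in> sets borel"
    have "(\<Sum>i. \<mu> (A i)) = (\<Sum>i. \<Sum>k. ennreal (m k (A i)))"
      using A(1) by (intro suminf_cong \<mu>) auto
    also have "\<dots> = (\<Sum>k. \<Sum>i. ennreal (m k (A i)))"
      by (rule suminf_ennreal_swap)
    also have "\<dots> = \<mu> (\<Union> (range A))"
      by (simp add: m_add[OF A(1,2)] \<mu>[OF A(3)])
    finally show "(\<Sum>i. \<mu> (A i)) = \<mu> (\<Union> (range A))" .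
  qed
  have pos: "positive (sets borel) \<mu>"
  proof -
    \<comment> \<open>Additivity for the sequence of empty sets is a convergent series with constant
      terms, which must therefore vanish.\<close>
    have "m k {} = 0" for k
      using sums_Re[OF PovmD(3)[OF M, of "\<lambda>_. {}" "v k" "v k"]]
      by (auto simp: disjoint_family_on_def m_def sums_iff summable_const_iff)
    then show ?thesis
      by (simp add: positive_def \<mu>)
  qed
  show ?thesis
    using emeasure_measure_of[OF outcome_measure_def[of r M], of B] ca pos B
    by (simp add: \<mu>_def[abs_def])
qed

lemma ctrace_product_id: "M \<in> Povm \<Longrightarrow> ctrace (\<lambda>x. r (M UNIV x)) = ctrace r"
  by (simp add: PovmD(4))

section \<open>Operator order under the trace, and integrals against sums of measures\<close>

lemma bounded_opI:
  fixes A :: "'a::complex_inner \<Rightarrow> 'a"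
  assumes "linear_op A" "\<And>x. Re (cinner (A x) (A x)) \<le> C * Re (cinner x x)"
  shows "bounded_op A"
proof -
  have "cnorm (A x) \<le> sqrt C * cnorm x" for x
    using real_sqrt_le_mono[OF assms(2)[of x]] by (simp add: cnorm_def real_sqrt_mult)
  then show ?thesis
    using assms(1) by (auto simp: bounded_op_def linear_op_def)
qed

lemma Re_cinner_add_le:
  fixes x y :: "'a::complex_inner"
  shows "Re (cinner (x + y) (x + y)) \<le> 2 * Re (cinner x x) + 2 * Re (cinner y y)"
  using cinner_nonneg[of "x - y"] by (simp add: cinner_simps)

lemma bounded_op_scaleC:
  fixes A :: "'a::complex_inner \<Rightarrow> 'a"
  assumes "bounded_op A"
  shows "bounded_op (\<lambda>x. scaleC c (A x))"
proof -
  note lin = bounded_op_linear[OF assms]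
  obtain C where C: "0 \<le> C" "\<And>x. Re (cinner (A x) (A x)) \<le> C * Re (cinner x x)"
    using bounded_op_norm_bound[OF assms] by blast
  have "Re (cinner (scaleC c z) (scaleC c z)) = (cmod c)\<^sup>2 * Re (cinner z z)" for z :: 'a
  proof -
    have "cinner (scaleC c z) (scaleC c z) = complex_of_real ((cmod c)\<^sup>2) * cinner z z"
      unfolding complex_norm_square by (simp add: cinner_simps)
    then show ?thesis by simp
  qed
  then have "Re (cinner (scaleC c (A x)) (scaleC c (A x))) \<le> (cmod c)\<^sup>2 * C * Re (cinner x x)" for x
    using mult_left_mono[OF C(2)[of x], of "(cmod c)\<^sup>2"] by (simp add: mult.assoc)
  then show ?thesis
    using lin by (intro bounded_opI[where C="(cmod c)\<^sup>2 * C"])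
      (auto simp: linear_op_def scaleC_add_right scaleC_scaleC mult.commute)
qed

lemma bounded_op_add:
  fixes A A' :: "'a::complex_inner \<Rightarrow> 'a"
  assumes "bounded_op A" "bounded_op A'"
  shows "bounded_op (\<lambda>x. A x + A' x)"
proof -
  obtain C where C: "\<And>x. Re (cinner (A x) (A x)) \<le> C * Re (cinner x x)"
    using bounded_op_norm_bound[OF assms(1)] by blast
  obtain C' where C': "\<And>x. Re (cinner (A' x) (A' x)) \<le> C' * Re (cinner x x)"
    using bounded_op_norm_bound[OF assms(2)] by blast
  have "Re (cinner (A x + A' x) (A x + A' x)) \<le> (2 * C + 2 * C') * Re (cinner x x)" for x
    using Re_cinner_add_le[of "A x" "A' x"] C[of x] C'[of x] by (simp add: algebra_simps)
  then show ?thesis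
    using bounded_op_linear[OF assms(1)] bounded_op_linear[OF assms(2)]
    by (intro bounded_opI[where C="2 * C + 2 * C'"]) (auto simp: linear_op_def scaleC_add_right)
qed

lemma scaleC_minus_one: "scaleC (- 1) x = - (x::'a::complex_inner)"
proof -
  have "scaleC 0 x = 0"
    using scaleC_add_left[of 0 0 x] by simp
  then show ?thesis
    using scaleC_add_left[of 1 "- 1" x] scaleC_one[of x] by (simp add: minus_unique)
qed

lemma bounded_op_diff:
  fixes A A' :: "'a::complex_inner \<Rightarrow> 'a"
  assumes "bounded_op A" "bounded_op A'"
  shows "bounded_op (\<lambda>x. A x - A' x)"
  using bounded_op_add[OF assms(1) bounded_op_scaleC[OF assms(2), of "- 1"]]
  by (simp add: scaleC_minus_one)

lemma pos_trace_class_add: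
  assumes "pos_trace_class r" "pos_trace_class s"
  shows "pos_trace_class (\<lambda>x. r x + s x)"
  using assms summable_on_add[of "\<lambda>b. cinner b (r b)" _ "\<lambda>b. cinner b (s b)"]
  by (auto simp: pos_trace_class_def bounded_op_add pos_op_def cinner_simps)

lemma ctrace_product_add:
  fixes r s :: "'a::chilbert \<Rightarrow> 'a"
  assumes "pos_trace_class r" "pos_trace_class s" "bounded_op A" "pos_op A"
  shows "ctrace (\<lambda>x. r (A x) + s (A x)) = ctrace (\<lambda>x. r (A x)) + ctrace (\<lambda>x. s (A x))"
  unfolding ctrace_def cinner_add_right
  by (intro infsum_add pos_trace_class_product assms)

text \<open>The difference s - r is itself positive with summable diagonal, so its trace pairing
  with A is nonnegative.\<close>

lemma ctrace_product_mono:
  fixes r s :: "'a::chilbert \<Rightarrow> 'a"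
  assumes r: "pos_trace_class r" and s: "pos_trace_class s" and le: "op_le r s"
    and A: "bounded_op A" "pos_op A"
  shows "Re (ctrace (\<lambda>x. r (A x))) \<le> Re (ctrace (\<lambda>x. s (A x)))"
proof -
  define d where "d x = s x - r x" for x
  have "(\<lambda>b. cinner b (s b) + - cinner b (r b)) summable_on (SOME B. onb B)"
    using r s by (intro summable_on_add summable_on_uminus[THEN iffD2]) (auto simp: pos_trace_class_def)
  then have d: "pos_trace_class d"
    using r s le unfolding pos_trace_class_def op_le_def d_def[abs_def]
    by (auto simp: bounded_op_diff cinner_simps)
  have "ctrace (\<lambda>x. s (A x)) = ctrace (\<lambda>x. r (A x) + d (A x))"
    by (simp add: d_def)
  also have "\<dots> = ctrace (\<lambda>x. r (A x)) + ctrace (\<lambda>x. d (A x))"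
    by (rule ctrace_product_add[OF r d A])
  finally show ?thesis
    using pos_trace_class_product(2)[OF d A] by simp
qed

text \<open>Lifts a setwise identity between measures to integrals. It is applied to mixtures of
  POVMs for a fixed state, and to sums of operators for a fixed POVM.\<close>

lemma nn_integral_affine_measure:
  fixes f :: "'a \<Rightarrow> ennreal"
  assumes sets: "sets P = sets N" "sets Q = sets N"
    and em: "\<And>A. A \<in> sets N \<Longrightarrow> emeasure N A = a * emeasure P A + b * emeasure Q A"
    and f: "f \<in> borel_measurable N"
  shows "(\<integral>\<^sup>+x. f x \<partial>N) = a * (\<integral>\<^sup>+x. f x \<partial>P) + b * (\<integral>\<^sup>+x. f x \<partial>Q)"
proof -
  have meas: "g \<in> borel_measurable P \<longleftrightarrow> g \<in> borel_measurable N"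
    "g \<in> borel_measurable Q \<longleftrightarrow> g \<in> borel_measurable N" for g :: "'a \<Rightarrow> ennreal"
    using measurable_cong_sets[OF sets(1) refl, of "borel :: ennreal measure"]
      measurable_cong_sets[OF sets(2) refl, of "borel :: ennreal measure"]
    by simp_all
  show ?thesis
    using f
  proof (induction f rule: borel_measurable_induct)
    case (cong f g)
    have "space P = space N" "space Q = space N"
      using sets by (auto dest: sets_eq_imp_space_eq)
    then have "(\<integral>\<^sup>+x. f x \<partial>N) = (\<integral>\<^sup>+x. g x \<partial>N)" "(\<integral>\<^sup>+x. f x \<partial>P) = (\<integral>\<^sup>+x. g x \<partial>P)"
      "(\<integral>\<^sup>+x. f x \<partial>Q) = (\<integral>\<^sup>+x. g x \<partial>Q)"
      using cong(3) by (auto intro!: nn_integral_cong)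
    then show ?case using cong(4) by simp
  next
    case (set A)
    then show ?case using sets em by simp
  next
    case (mult u c)
    then have "u \<in> borel_measurable P" "u \<in> borel_measurable Q"
      by (simp_all add: meas)
    then show ?case
      using mult by (simp add: nn_integral_cmult distrib_left mult.left_commute)
  next
    case (add u v)
    then have "u \<in> borel_measurable P" "u \<in> borel_measurable Q" "v \<in> borel_measurable P" "v \<in> borel_measurable Q"
      by (simp_all add: meas)
    then show ?case
      using add by (simp add: nn_integral_add distrib_left ac_simps)
  next
    case (seq U)
    have meas': "U i \<in> borel_measurable P" "U i \<in> borel_measurable Q" for i
      using seq(1) by (simp_all add: meas)
    have mono: "incseq (\<lambda>i. a * integral\<^sup>N P (U i))" "incseq (\<lambda>i. b * integral\<^sup>N Q (U i))"
      using seq(3) by (auto simp: incseq_def le_fun_def intro!: mult_left_mono nn_integral_mono)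
    have "(\<integral>\<^sup>+x. (SUP i. U i) x \<partial>N) = (SUP i. integral\<^sup>N N (U i))"
      unfolding SUP_apply using seq by (intro nn_integral_monotone_convergence_SUP) auto
    also have "\<dots> = (SUP i. a * integral\<^sup>N P (U i) + b * integral\<^sup>N Q (U i))"
      using seq.IH by simp
    also have "\<dots> = (SUP i. a * integral\<^sup>N P (U i)) + (SUP i. b * integral\<^sup>N Q (U i))"
      by (rule ennreal_SUP_add[OF mono])
    also have "\<dots> = a * (SUP i. integral\<^sup>N P (U i)) + b * (SUP i. integral\<^sup>N Q (U i))"
      by (simp add: SUP_mult_left_ennreal)
    also have "(SUP i. integral\<^sup>N P (U i)) = (\<integral>\<^sup>+x. (SUP i. U i) x \<partial>P)"
      unfolding SUP_apply using seq(3) meas' by (intro nn_integral_monotone_convergence_SUP[symmetric]) auto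
    also have "(SUP i. integral\<^sup>N Q (U i)) = (\<integral>\<^sup>+x. (SUP i. U i) x \<partial>Q)"
      unfolding SUP_apply using seq(3) meas' by (intro nn_integral_monotone_convergence_SUP[symmetric]) auto
    finally show ?case .
  qed
qed

section \<open>Risk functions\<close>

definition povm_mix :: "real \<Rightarrow> ('u set \<Rightarrow> 'a::complex_inner \<Rightarrow> 'a) \<Rightarrow> ('u set \<Rightarrow> 'a \<Rightarrow> 'a) \<Rightarrow> 'u set \<Rightarrow> 'a \<Rightarrow> 'a"
  where "povm_mix t M N B x = scaleC (complex_of_real t) (M B x) + scaleC (complex_of_real (1 - t)) (N B x)"

lemma povm_mix_Povm:
  fixes M N :: "'u::topological_space set \<Rightarrow> 'a::complex_inner \<Rightarrow> 'a"
  assumes "0 \<le> t" "t \<le> 1" and M: "M \<in> Povm" and N: "N \<in> Povm"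
  shows "povm_mix t M N \<in> Povm"
proof -
  have "bounded_op (povm_mix t M N B) \<and> pos_op (povm_mix t M N B)" if "B \<in> sets borel" for B
  proof
    show "bounded_op (povm_mix t M N B)"
      unfolding povm_mix_def[abs_def]
      by (intro bounded_op_add bounded_op_scaleC PovmD(1)[OF M that] PovmD(1)[OF N that])
    show "pos_op (povm_mix t M N B)"
      using PovmD(2)[OF M that] PovmD(2)[OF N that] assms(1,2)
      by (simp add: pos_op_def povm_mix_def cinner_simps)
  qed
  moreover have "(\<lambda>j. cinner x (povm_mix t M N (Bs j) y)) sums cinner x (povm_mix t M N (\<Union>j. Bs j) y)"
    if "range Bs \<subseteq> sets borel" "disjoint_family Bs" for Bs :: "nat \<Rightarrow> 'u set" and x y
    unfolding povm_mix_def cinner_add_right cinner_scaleC_right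
    by (intro sums_add sums_mult PovmD(3)[OF M that] PovmD(3)[OF N that])
  moreover have "povm_mix t M N UNIV = id"
    by (rule ext) (simp add: povm_mix_def PovmD(4)[OF M] PovmD(4)[OF N] scaleC_one
        flip: scaleC_add_left)
  moreover have "povm_mix t M N B = (\<lambda>_. 0)" if "B \<notin> sets borel" for B
    by (rule ext) (simp add: povm_mix_def PovmD(5)[OF M that] PovmD(5)[OF N that] scaleC_zero_right)
  ultimately show ?thesis
    unfolding Povm_def by blast
qed

text \<open>The witness always reports one fixed outcome u, a Dirac mass times the identity.
  Nonemptiness is needed because infima of reals over the empty set are meaningless.\<close>

lemma Povm_nonempty: "(Povm :: ('u::topological_space set \<Rightarrow> 'a::complex_inner \<Rightarrow> 'a) set) \<noteq> {}"
proof -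
  define u :: 'u where "u = undefined"
  define M :: "'u set \<Rightarrow> 'a \<Rightarrow> 'a" where "M B x = (if B \<in> sets borel \<and> u \<in> B then x else 0)" for B x
  have "bounded_op (M B) \<and> pos_op (M B)" for B
  proof
    show "bounded_op (M B)"
      by (rule bounded_opI[where C=1]) (auto simp: linear_op_def M_def scaleC_zero_right cinner_nonneg)
    show "pos_op (M B)"
      by (simp add: pos_op_def M_def cinner_nonneg)
  qed
  moreover have "(\<lambda>j. cinner x (M (Bs j) y)) sums cinner x (M (\<Union>j. Bs j) y)"
    if Bs: "range Bs \<subseteq> sets borel" "disjoint_family Bs" for Bs :: "nat \<Rightarrow> 'u set" and x y
  proof (cases "u \<in> (\<Union>j. Bs j)")
    case True
    then obtain i where i: "u \<in> Bs i" by blast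
    have "cinner x (M (Bs j) y) = (if j = i then cinner x y else 0)" for j
      using Bs i by (auto simp: M_def disjoint_family_on_def)
    then have "(\<lambda>j. cinner x (M (Bs j) y)) sums cinner x y"
      using sums_single[of i "\<lambda>_. cinner x y"] by simp
    moreover have "(\<Union>j. Bs j) \<in> sets borel"
      using Bs(1) by auto
    ultimately show ?thesis
      using True by (simp add: M_def)
  next
    case False
    then show ?thesis by (simp add: M_def)
  qed
  moreover have "M UNIV = id" "\<And>B. B \<notin> sets borel \<Longrightarrow> M B = (\<lambda>_. 0)"
    by (auto simp: M_def fun_eq_iff)
  ultimately have "M \<in> Povm"
    unfolding Povm_def by blast
  then show ?thesis by blast
qed

lemma emeasure_outcome_mix:
  fixes r :: "'a::chilbert \<Rightarrow> 'a"
  assumes r: "pos_trace_class r" and t: "0 \<le> t" "t \<le> 1" and M: "M \<in> Povm" and N: "N \<in> Povm"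
    and B: "B \<in> sets borel"
  shows "emeasure (outcome_measure r (povm_mix t M N)) B
     = ennreal t * emeasure (outcome_measure r M) B + ennreal (1 - t) * emeasure (outcome_measure r N) B"
proof -
  have lin: "linear_op r"
    using r by (simp add: pos_trace_class_def bounded_op_linear)
  note tM = pos_trace_class_product[OF r PovmD(1)[OF M B] PovmD(2)[OF M B]]
  note tN = pos_trace_class_product[OF r PovmD(1)[OF N B] PovmD(2)[OF N B]]
  have "ctrace (\<lambda>x. r (povm_mix t M N B x))
      = complex_of_real t * ctrace (\<lambda>x. r (M B x)) + complex_of_real (1 - t) * ctrace (\<lambda>x. r (N B x))"
    unfolding ctrace_def povm_mix_def linear_op_add[OF lin] linear_op_scaleC[OF lin]
      cinner_add_right cinner_scaleC_right
    by (subst infsum_add) (auto intro!: summable_on_cmult_right tM tN simp: infsum_cmult_right')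
  then have "Re (ctrace (\<lambda>x. r (povm_mix t M N B x)))
      = t * Re (ctrace (\<lambda>x. r (M B x))) + (1 - t) * Re (ctrace (\<lambda>x. r (N B x)))"
    by simp
  then show ?thesis
    using tM(2) tN(2) t by (simp add: emeasure_outcome_measure[OF r _ B] M N povm_mix_Povm
        ennreal_plus ennreal_mult)
qed

text \<open>Writing the comparison as r below s + X, not r - s below X, keeps every operator
  positive, so that every trace pairing involved is a genuine measure.\<close>

lemma nn_integral_outcome_le:
  fixes r s :: "'a::chilbert \<Rightarrow> 'a" and f :: "'u::topological_space \<Rightarrow> ennreal"
  assumes r: "pos_trace_class r" and s: "pos_trace_class s" and X: "pos_trace_class X"
    and le: "op_le r (\<lambda>x. s x + X x)" and M: "M \<in> Povm" and f: "f \<in> borel_measurable borel"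
  shows "(\<integral>\<^sup>+u. f u \<partial>outcome_measure r M)
    \<le> (\<integral>\<^sup>+u. f u \<partial>outcome_measure s M) + (\<integral>\<^sup>+u. f u \<partial>outcome_measure X M)"
proof -
  define y where "y x = s x + X x" for x
  have y: "pos_trace_class y"
    unfolding y_def[abs_def] by (rule pos_trace_class_add[OF s X])
  have "emeasure (outcome_measure r M) B \<le> emeasure (outcome_measure y M) B" if B: "B \<in> sets borel" for B
    unfolding emeasure_outcome_measure[OF r M B] emeasure_outcome_measure[OF y M B]
    using le by (intro ennreal_leI ctrace_product_mono r y PovmD[OF M] B) (simp add: y_def[abs_def])
  then have "outcome_measure r M \<le> outcome_measure y M"
    by (subst le_measure) (auto simp: le_fun_def)
  then have "(\<integral>\<^sup>+u. f u \<partial>outcome_measure r M) \<le> (\<integral>\<^sup>+u. f u \<partial>outcome_measure y M)"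
    by (intro nn_integral_mono_measure) simp_all
  also have "\<dots> = 1 * (\<integral>\<^sup>+u. f u \<partial>outcome_measure s M) + 1 * (\<integral>\<^sup>+u. f u \<partial>outcome_measure X M)"
  proof (rule nn_integral_affine_measure)
    fix B assume "B \<in> sets (outcome_measure y M)"
    then have B: "B \<in> sets borel" by simp
    note A = PovmD(1)[OF M B] PovmD(2)[OF M B]
    have "Re (ctrace (\<lambda>x. y (M B x))) = Re (ctrace (\<lambda>x. s (M B x))) + Re (ctrace (\<lambda>x. X (M B x)))"
      unfolding y_def using ctrace_product_add[OF s X A] by simp
    then show "emeasure (outcome_measure y M) B
      = 1 * emeasure (outcome_measure s M) B + 1 * emeasure (outcome_measure X M) B"
      using pos_trace_class_product(2)[OF s A] pos_trace_class_product(2)[OF X A]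
      by (simp add: emeasure_outcome_measure[OF _ M B] s X y ennreal_plus)
  qed (use f in \<open>simp_all cong: measurable_cong_sets\<close>)
  finally show ?thesis by simp
qed

section \<open>Risk functions: affine in the POVM and equicontinuous in the parameter\<close>

locale quantum_decision =
  fixes \<rho> :: "'t::metric_space \<Rightarrow> 'h::chilbert \<Rightarrow> 'h"
    and w :: "'t \<Rightarrow> 'u::metric_space \<Rightarrow> real"
  assumes compact_params: "compact (UNIV :: 't set)" and compact_outcomes: "compact (UNIV :: 'u set)"
    and model: "quantum_model \<rho>"
    and continuous_loss: "continuous_on UNIV (\<lambda>(\<theta>, u). w \<theta> u)"
    and loss_nonneg: "\<And>\<theta> u. 0 \<le> w \<theta> u"
begin

lemma pos_trace_class_state: "pos_trace_class (\<rho> \<theta>)"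
  using model trace_class_diagonal(1)[of "\<rho> \<theta>"]
  by (auto simp: quantum_model_def pos_trace_class_def trace_class_def)

lemma loss_measurable [measurable]: "w \<theta> \<in> borel_measurable borel"
proof -
  have "continuous_on UNIV (\<lambda>u. (\<lambda>(\<theta>, u). w \<theta> u) (\<theta>, u))"
    by (rule continuous_on_compose2[OF continuous_loss]) (auto intro!: continuous_intros)
  then show ?thesis
    by (intro borel_measurable_continuous_onI) simp
qed

lemma compact_product: "compact (UNIV :: ('t \<times> 'u) set)"
  using compact_Times[OF compact_params compact_outcomes] by simp

lemma loss_bounded: obtains W where "0 \<le> W" "\<And>\<theta> u. w \<theta> u \<le> W"
proof -
  have "bounded ((\<lambda>(\<theta>, u). w \<theta> u) ` UNIV)"
    by (intro compact_imp_bounded compact_continuous_image continuous_loss compact_product)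
  then obtain W where "\<And>p. norm ((\<lambda>(\<theta>, u). w \<theta> u) p) \<le> W"
    by (auto simp: bounded_iff)
  then have "\<bar>w \<theta> u\<bar> \<le> W" for \<theta> u
    by (metis case_prod_conv real_norm_def)
  then show thesis
    by (metis abs_ge_self abs_ge_zero order_trans that)
qed

lemma prob_space_outcome: "M \<in> Povm \<Longrightarrow> prob_space (outcome_measure (\<rho> \<theta>) M)"
  using emeasure_outcome_measure[OF pos_trace_class_state, of M UNIV \<theta>] model
  by (intro prob_spaceI) (simp add: ctrace_product_id quantum_model_def)

text \<open>The loss is bounded and the outcome distribution is a probability, so the Bochner
  integral in \<open>risk\<close> is no default value. Later estimates are made in
  \<open>ennreal\<close>, where integrability is no concern.\<close>

lemma ennreal_risk:
  assumes M: "M \<in> Povm"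
  shows "ennreal (risk \<rho> w M \<theta>) = (\<integral>\<^sup>+u. ennreal (w \<theta> u) \<partial>outcome_measure (\<rho> \<theta>) M)"
proof -
  interpret prob_space "outcome_measure (\<rho> \<theta>) M"
    by (rule prob_space_outcome[OF M])
  obtain W where "0 \<le> W" "\<And>\<theta> u. w \<theta> u \<le> W"
    using loss_bounded by blast
  then have "integrable (outcome_measure (\<rho> \<theta>) M) (w \<theta>)"
    using loss_nonneg by (intro integrable_const_bound[of _ W]) auto
  then show ?thesis
    unfolding risk_def using loss_nonneg by (intro nn_integral_eq_integral[symmetric]) auto
qed

lemma risk_nonneg: "0 \<le> risk \<rho> w M \<theta>"
  unfolding risk_def using loss_nonneg by (intro Bochner_Integration.integral_nonneg) auto

lemma risk_le:
  assumes "M \<in> Povm" "\<And>u. w \<theta> u \<le> W"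
  shows "risk \<rho> w M \<theta> \<le> W"
proof -
  interpret prob_space "outcome_measure (\<rho> \<theta>) M"
    by (rule prob_space_outcome[OF assms(1)])
  have "0 \<le> W"
    using assms(2) loss_nonneg order_trans by blast
  have "ennreal (risk \<rho> w M \<theta>) \<le> (\<integral>\<^sup>+u. ennreal W \<partial>outcome_measure (\<rho> \<theta>) M)"
    unfolding ennreal_risk[OF assms(1)] by (intro nn_integral_mono ennreal_leI assms(2))
  also have "\<dots> = ennreal W"
    using emeasure_space_1 by simp
  finally show ?thesis
    using \<open>0 \<le> W\<close> by simp
qed

lemma risk_mix:
  assumes "0 \<le> t" "t \<le> 1" "M \<in> Povm" "N \<in> Povm"
  shows "risk \<rho> w (povm_mix t M N) \<theta> = t * risk \<rho> w M \<theta> + (1 - t) * risk \<rho> w N \<theta>"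
proof -
  have "ennreal (risk \<rho> w (povm_mix t M N) \<theta>)
      = ennreal t * ennreal (risk \<rho> w M \<theta>) + ennreal (1 - t) * ennreal (risk \<rho> w N \<theta>)"
    unfolding ennreal_risk[OF povm_mix_Povm[OF assms]] ennreal_risk[OF assms(3)] ennreal_risk[OF assms(4)]
    using emeasure_outcome_mix[OF pos_trace_class_state assms]
    by (intro nn_integral_affine_measure) simp_all
  also have "\<dots> = ennreal (t * risk \<rho> w M \<theta> + (1 - t) * risk \<rho> w N \<theta>)"
    using assms(1,2) by (simp add: ennreal_plus ennreal_mult risk_nonneg)
  finally show ?thesis
    using assms(1,2) by (subst (asm) ennreal_inj) (auto simp: risk_nonneg)
qed

text \<open>Two exchanges: replacing the loss at \<theta> by that at \<eta> costs \<epsilon> under a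
  probability; replacing the state costs the integral of the loss against the measure of X, at most
  W times its total mass \<open>Tr X\<close>, whatever M is.\<close>

lemma risk_le_add:
  assumes M: "M \<in> Povm" and w: "\<And>u. w \<theta> u \<le> w \<eta> u + \<epsilon>" and W: "\<And>u. w \<eta> u \<le> W"
    and X: "pos_trace_class X" "Re (ctrace X) \<le> \<epsilon>"
    and le: "op_le (\<lambda>x. \<rho> \<theta> x - \<rho> \<eta> x) X" and "0 \<le> \<epsilon>"
  shows "risk \<rho> w M \<theta> \<le> risk \<rho> w M \<eta> + (W + 1) * \<epsilon>"
proof -
  interpret prob_space "outcome_measure (\<rho> \<theta>) M"
    by (rule prob_space_outcome[OF M])
  have "0 \<le> W"
    using W loss_nonneg order_trans by blast
  have le': "op_le (\<rho> \<theta>) (\<lambda>x. \<rho> \<eta> x + X x)"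
    using le by (simp add: op_le_def algebra_simps)
  have "ennreal (risk \<rho> w M \<theta>) \<le> (\<integral>\<^sup>+u. ennreal (w \<eta> u) + ennreal \<epsilon> \<partial>outcome_measure (\<rho> \<theta>) M)"
    unfolding ennreal_risk[OF M] using w loss_nonneg \<open>0 \<le> \<epsilon>\<close>
    by (intro nn_integral_mono) (simp flip: ennreal_plus)
  also have "\<dots> = (\<integral>\<^sup>+u. ennreal (w \<eta> u) \<partial>outcome_measure (\<rho> \<theta>) M) + ennreal \<epsilon>"
    using emeasure_space_1 by (subst nn_integral_add) auto
  also have "(\<integral>\<^sup>+u. ennreal (w \<eta> u) \<partial>outcome_measure (\<rho> \<theta>) M)
      \<le> (\<integral>\<^sup>+u. ennreal (w \<eta> u) \<partial>outcome_measure (\<rho> \<eta>) M) + (\<integral>\<^sup>+u. ennreal (w \<eta> u) \<partial>outcome_measure X M)"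
    by (intro nn_integral_outcome_le pos_trace_class_state X le' M) measurable
  also have "(\<integral>\<^sup>+u. ennreal (w \<eta> u) \<partial>outcome_measure X M) \<le> (\<integral>\<^sup>+u. ennreal W \<partial>outcome_measure X M)"
    by (intro nn_integral_mono ennreal_leI W)
  also have "\<dots> = ennreal W * ennreal (Re (ctrace X))"
    using emeasure_outcome_measure[OF X(1) M, of UNIV] by (simp add: ctrace_product_id[OF M])
  also have "\<dots> \<le> ennreal W * ennreal \<epsilon>"
    by (intro mult_left_mono ennreal_leI X(2)) simp
  finally have "ennreal (risk \<rho> w M \<theta>) \<le> ennreal (risk \<rho> w M \<eta>) + ennreal W * ennreal \<epsilon> + ennreal \<epsilon>"
    unfolding ennreal_risk[OF M, of \<eta>] by (simp add: add_mono)
  also have "\<dots> = ennreal (risk \<rho> w M \<eta> + (W + 1) * \<epsilon>)"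
    using \<open>0 \<le> W\<close> \<open>0 \<le> \<epsilon>\<close> by (simp add: ennreal_plus ennreal_mult risk_nonneg algebra_simps)
  finally show ?thesis
    using \<open>0 \<le> W\<close> \<open>0 \<le> \<epsilon>\<close> by (subst (asm) ennreal_le_iff) (auto simp: risk_nonneg)
qed

lemma risk_equicontinuous:
  assumes "0 < e"
  obtains \<delta> where "0 < \<delta>"
    "\<And>M \<theta> \<eta>. M \<in> Povm \<Longrightarrow> dist \<theta> \<eta> < \<delta> \<Longrightarrow> \<bar>risk \<rho> w M \<theta> - risk \<rho> w M \<eta>\<bar> \<le> e"
proof -
  obtain W where W: "0 \<le> W" "\<And>\<theta> u. w \<theta> u \<le> W"
    using loss_bounded by blast
  \<comment> \<open>Chosen so that the total loss \<open>(W + 1) * \<epsilon>\<close> of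
    \<open>risk_le_add\<close> is e.\<close>
  define \<epsilon> where "\<epsilon> = e / (W + 1)"
  have \<epsilon>: "0 < \<epsilon>" "(W + 1) * \<epsilon> = e"
    using assms W(1) by (auto simp: \<epsilon>_def)
  have "uniformly_continuous_on UNIV (\<lambda>(\<theta>, u). w \<theta> u)"
    by (intro compact_uniformly_continuous continuous_loss compact_product)
  then obtain d1 where d1: "0 < d1"
    and "\<And>p q. dist p q < d1 \<Longrightarrow> dist ((\<lambda>(\<theta>, u). w \<theta> u) p) ((\<lambda>(\<theta>, u). w \<theta> u) q) < \<epsilon>"
    using \<open>0 < \<epsilon>\<close> unfolding uniformly_continuous_on_def by (metis UNIV_I dist_commute)
  from this(2)[of "(_, u)" "(_, u)" for u] have w: "\<bar>w \<theta> u - w \<eta> u\<bar> < \<epsilon>" if "dist \<theta> \<eta> < d1" for \<theta> \<eta> u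
    using that by (simp add: dist_Pair_Pair dist_real_def)
  have "((\<lambda>\<delta>. omega \<rho> UNIV \<delta>) \<longlongrightarrow> 0) (at_right 0)"
    using model compact_params by (simp add: quantum_model_def regular_def)
  then have "\<forall>\<^sub>F \<delta> in at_right 0. omega \<rho> UNIV \<delta> < ereal \<epsilon>"
    using \<epsilon>(1) by (intro order_tendstoD) (auto simp: zero_ereal_def)
  then obtain d2 where d2: "0 < d2" "omega \<rho> UNIV d2 < ereal \<epsilon>"
    unfolding eventually_at_right_field by (metis dense)
  then obtain X where X: "trace_class X" "trace_norm X < ereal \<epsilon>"
    and XD: "\<And>\<theta> \<eta>. dist \<theta> \<eta> < d2 \<Longrightarrow> op_le (\<lambda>x. - X x) (\<lambda>x. \<rho> \<theta> x - \<rho> \<eta> x)"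
      "\<And>\<theta> \<eta>. dist \<theta> \<eta> < d2 \<Longrightarrow> op_le (\<lambda>x. \<rho> \<theta> x - \<rho> \<eta> x) X"
    unfolding omega_def INF_less_iff by auto
  \<comment> \<open>Equal parameters in the two-sided bound give -X below 0, that is, positivity of
    the dominating operator.\<close>
  have "op_le (\<lambda>x. - X x) (\<lambda>x. \<rho> \<theta> x - \<rho> \<theta> x)" for \<theta>
    using XD(1)[of \<theta> \<theta>] d2(1) by simp
  then have "pos_op X"
    by (simp add: op_le_def)
  then have X_ptc: "pos_trace_class X"
    using X(1) trace_class_diagonal(1)[OF X(1)] by (simp add: pos_trace_class_def trace_class_def)
  have X_le: "Re (ctrace X) \<le> \<epsilon>"
    using trace_class_diagonal(2)[OF X(1)] X(2) by (metis ereal_less_eq(3) less_imp_le order_trans)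
  have one: "risk \<rho> w M \<theta> \<le> risk \<rho> w M \<eta> + e" if M: "M \<in> Povm" and d: "dist \<theta> \<eta> < min d1 d2" for M \<theta> \<eta>
  proof -
    have "w \<theta> u \<le> w \<eta> u + \<epsilon>" for u
      using w[of \<theta> \<eta> u] d by simp
    then show ?thesis
      using risk_le_add[OF M _ W(2) X_ptc X_le XD(2), of \<theta> \<eta>] \<epsilon> d by simp
  qed
  show thesis
  proof (rule that[of "min d1 d2"])
    fix M :: "'u set \<Rightarrow> 'h \<Rightarrow> 'h" and \<theta> \<eta> :: 't
    assume "M \<in> Povm" "dist \<theta> \<eta> < min d1 d2"
    then show "\<bar>risk \<rho> w M \<theta> - risk \<rho> w M \<eta>\<bar> \<le> e"
      using one[of M \<theta> \<eta>] one[of M \<eta> \<theta>] by (simp add: dist_commute)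
  qed (use d1 d2 in auto)
qed

end

section \<open>Minimax weights on a finite set\<close>

text \<open>A line separates P from the open negative quadrant; its normal has nonnegative
  coordinates, and dividing by their sum gives the weights.\<close>

lemma convex_pairs_weights:
  fixes P :: "(real \<times> real) set"
  assumes "convex P" and quad: "\<And>a b. (a, b) \<in> P \<Longrightarrow> 0 \<le> a \<or> 0 \<le> b"
  obtains t where "0 \<le> t" "t \<le> 1" "\<And>a b. (a, b) \<in> P \<Longrightarrow> 0 \<le> t * a + (1 - t) * b"
proof (cases "P = {}")
  case True
  then show thesis by (intro that[of 0]) auto
next
  case False
  define N :: "(real \<times> real) set" where "N = {..<0} \<times> {..<0}"
  have "convex N"
    unfolding N_def by (intro convex_Times) auto
  moreover have "(- 1, - 1) \<in> N" "N \<inter> P = {}"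
    using quad by (force simp: N_def)+
  ultimately obtain c d where c: "c \<noteq> 0" and cN: "\<forall>x\<in>N. inner c x \<le> d" and cP: "\<forall>x\<in>P. inner c x \<ge> d"
    using separating_hyperplane_sets[of N P] assms(1) False by blast
  obtain \<alpha> \<beta> where ab: "c = (\<alpha>, \<beta>)" by (cases c)
  have le: "\<alpha> * x + \<beta> * y \<le> d" if "x < 0" "y < 0" for x y
    using bspec[OF cN, of "(x, y)"] that by (simp add: ab N_def)
  have nonneg: "0 \<le> \<gamma>" if le: "\<And>x y. x < 0 \<Longrightarrow> y < 0 \<Longrightarrow> \<gamma> * x + \<delta> * y \<le> d" for \<gamma> \<delta>
  proof (rule ccontr)
    assume "\<not> 0 \<le> \<gamma>"
    \<comment> \<open>If \<gamma> were negative, this point of the quadrant would give the value |d|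
      + |\<delta>| + 1 - \<delta>, which exceeds d.\<close>
    then have "\<gamma> * ((\<bar>d\<bar> + \<bar>\<delta>\<bar> + 1) / \<gamma>) + \<delta> * (- 1) \<le> d"
      by (intro le) (auto simp: divide_neg_neg divide_pos_neg add_nonneg_pos)
    then show False
      using \<open>\<not> 0 \<le> \<gamma>\<close> by simp
  qed
  have "0 \<le> \<alpha>"
    using nonneg[OF le] .
  moreover have "0 \<le> \<beta>"
    using nonneg[of \<beta> \<alpha>] le by (simp add: add.commute)
  moreover have "\<alpha> \<noteq> 0 \<or> \<beta> \<noteq> 0"
    using c ab by (auto simp: zero_prod_def)
  ultimately have pos: "0 < \<alpha> + \<beta>" "0 \<le> \<alpha>" "0 \<le> \<beta>"
    by auto
  have "0 \<le> d"
  proof (rule ccontr)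
    assume "\<not> 0 \<le> d"
    \<comment> \<open>For negative d this diagonal point lies in the quadrant and has value d / 2,
      which is larger than d.\<close>
    then have "\<alpha> * (d / (2 * (\<alpha> + \<beta>))) + \<beta> * (d / (2 * (\<alpha> + \<beta>))) \<le> d"
      using pos by (intro le) (auto simp: divide_neg_pos)
    moreover have "(\<alpha> + \<beta>) * (d / (2 * (\<alpha> + \<beta>))) = d / 2"
      using pos(1) by (simp add: divide_simps)
    then have "\<alpha> * (d / (2 * (\<alpha> + \<beta>))) + \<beta> * (d / (2 * (\<alpha> + \<beta>))) = d / 2"
      by (simp only: distrib_right)
    ultimately show False
      using \<open>\<not> 0 \<le> d\<close> by simp
  qed
  show thesis
  proof (rule that[of "\<alpha> / (\<alpha> + \<beta>)"])
    fix a b assume "(a, b) \<in> P"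
    then have "0 \<le> \<alpha> * a + \<beta> * b"
      using cP \<open>0 \<le> d\<close> by (fastforce simp: ab)
    then have "0 \<le> (\<alpha> * a + \<beta> * b) / (\<alpha> + \<beta>)"
      using pos by simp
    also have "\<dots> = \<alpha> / (\<alpha> + \<beta>) * a + \<beta> / (\<alpha> + \<beta>) * b"
      by (simp add: add_divide_distrib)
    also have "\<beta> / (\<alpha> + \<beta>) = 1 - \<alpha> / (\<alpha> + \<beta>)"
      using pos(1) by (simp add: divide_simps)
    finally show "0 \<le> \<alpha> / (\<alpha> + \<beta>) * a + (1 - \<alpha> / (\<alpha> + \<beta>)) * b" .
  qed (use pos in auto)
qed

text \<open>Induction on the index set reduces everything to two coordinates. The v with v j < 0
  again form a convex family, and their nonnegative coordinate must lie in I; the weights p found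
  for them merge I into one coordinate, leaving the pair case.\<close>

lemma finite_minimax_weights:
  fixes V :: "('i \<Rightarrow> real) set"
  assumes "finite I" "I \<noteq> {}"
    and "\<And>u v t. u \<in> V \<Longrightarrow> v \<in> V \<Longrightarrow> 0 \<le> t \<Longrightarrow> t \<le> 1 \<Longrightarrow> (\<lambda>i. t * u i + (1 - t) * v i) \<in> V"
    and "\<And>v. v \<in> V \<Longrightarrow> \<exists>i\<in>I. 0 \<le> v i"
  shows "\<exists>p. (\<forall>i\<in>I. 0 \<le> p i) \<and> sum p I = 1 \<and> (\<forall>v\<in>V. 0 \<le> (\<Sum>i\<in>I. p i * v i))"
  using assms
proof (induction I arbitrary: V rule: finite_ne_induct)
  case (singleton j)
  then show ?case by (intro exI[of _ "\<lambda>_. 1"]) auto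
next
  case (insert j I)
  define V' where "V' = {v\<in>V. v j < 0}"
  have "\<exists>p. (\<forall>i\<in>I. 0 \<le> p i) \<and> sum p I = 1 \<and> (\<forall>v\<in>V'. 0 \<le> (\<Sum>i\<in>I. p i * v i))"
  proof (rule insert.IH)
    fix u v :: "'i \<Rightarrow> real" and t :: real
    assume uv: "u \<in> V'" "v \<in> V'" "0 \<le> t" "t \<le> 1"
    have "t * u j + (1 - t) * v j < 0"
      using uv convex_bound_lt[of "u j" 0 "v j" t "1 - t"] by (simp add: V'_def)
    then show "(\<lambda>i. t * u i + (1 - t) * v i) \<in> V'"
      using uv insert.prems(1) by (auto simp: V'_def)
  next
    fix v assume "v \<in> V'"
    then show "\<exists>i\<in>I. 0 \<le> v i"
      using insert.prems(2)[of v] by (auto simp: V'_def)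
  qed
  then obtain p where p: "\<forall>i\<in>I. 0 \<le> p i" "sum p I = 1" "\<forall>v\<in>V'. 0 \<le> (\<Sum>i\<in>I. p i * v i)"
    by blast
  define P where "P = (\<lambda>v. (\<Sum>i\<in>I. p i * v i, v j)) ` V"
  have "convex P"
    unfolding convex_alt
  proof (intro ballI allI impI)
    fix x y and s :: real
    assume "x \<in> P" "y \<in> P" and s: "0 \<le> s \<and> s \<le> 1"
    then obtain u v where uv: "u \<in> V" "v \<in> V" "x = (\<Sum>i\<in>I. p i * u i, u j)" "y = (\<Sum>i\<in>I. p i * v i, v j)"
      by (auto simp: P_def)
    have mem: "(\<lambda>i. s * v i + (1 - s) * u i) \<in> V"
      using insert.prems(1)[OF uv(2,1)] s by blast
    have eq: "(1 - s) *\<^sub>R x + s *\<^sub>R y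
        = (\<Sum>i\<in>I. p i * (s * v i + (1 - s) * u i), s * v j + (1 - s) * u j)"
      by (simp add: uv sum_distrib_left distrib_left sum.distrib mult.left_commute)
    show "(1 - s) *\<^sub>R x + s *\<^sub>R y \<in> P"
      unfolding P_def eq using imageI[OF mem, of "\<lambda>v. (\<Sum>i\<in>I. p i * v i, v j)"] by simp
  qed
  \<comment> \<open>Either v j is nonnegative, or v lies in V' and the weighted sum over I
    is.\<close>
  moreover have "0 \<le> a \<or> 0 \<le> b" if "(a, b) \<in> P" for a b
    using that p(3) by (force simp: P_def V'_def)
  ultimately obtain t where t: "0 \<le> t" "t \<le> 1" "\<And>a b. (a, b) \<in> P \<Longrightarrow> 0 \<le> t * a + (1 - t) * b"
    using convex_pairs_weights by metis
  define p' where "p' i = (if i = j then 1 - t else t * p i)" for i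
  have eq: "(\<Sum>i\<in>I. p' i * v i) = t * (\<Sum>i\<in>I. p i * v i)" for v
    unfolding sum_distrib_left using \<open>j \<notin> I\<close> by (intro sum.cong) (auto simp: p'_def)
  show ?case
  proof (intro exI[of _ p'] conjI ballI)
    show "0 \<le> p' i" if "i \<in> insert j I" for i
      using that p(1) t by (auto simp: p'_def)
    show "sum p' (insert j I) = 1"
      using eq[of "\<lambda>_. 1"] p(2) insert.hyps by (simp add: p'_def)
    show "0 \<le> (\<Sum>i\<in>insert j I. p' i * v i)" if "v \<in> V" for v
      using eq[of v] insert.hyps t(3)[of "\<Sum>i\<in>I. p i * v i" "v j"] that
      by (simp add: p'_def P_def add.commute)
  qed
qed

section \<open>Weak compactness of the set of priors\<close>

text \<open>The sets are the balls of finite nets of radius 1 / (m + 1). Two points lying in the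
  same balls share a small one, so finitely many membership bits locate a point up to
  \<epsilon>.\<close>

lemma compact_separating_sets:
  assumes "compact (UNIV :: 't::metric_space set)"
  obtains A :: "nat \<Rightarrow> 't::metric_space set" where "\<And>i. open (A i)"
    "\<And>\<epsilon>. 0 < \<epsilon> \<Longrightarrow> \<exists>N. \<forall>x y. (\<forall>i<N. x \<in> A i \<longleftrightarrow> y \<in> A i) \<longrightarrow> dist x y < \<epsilon>"
proof -
  have "\<exists>F. finite F \<and> UNIV = (\<Union>x\<in>F. ball x (1 / real (Suc m)) :: 't set)" for m
  proof -
    have "\<exists>F. finite F \<and> UNIV \<subseteq> (\<Union>x\<in>F. ball x (1 / real (Suc m)) :: 't set)"
      using assms unfolding compact_eq_totally_bounded by simp
    then show ?thesis by blast
  qed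
  then obtain F where F: "\<And>m. finite (F m)" "\<And>m. UNIV = (\<Union>x\<in>F m. ball x (1 / real (Suc m)) :: 't set)"
    by metis
  define \<A> where "\<A> = insert UNIV (\<Union>m. (\<lambda>x. ball x (1 / real (Suc m))) ` F m)"
  have "countable \<A>"
    unfolding \<A>_def by (intro countable_insert countable_UN countableI_type countable_finite finite_imageI F(1))
  define A where "A = from_nat_into \<A>"
  have range_A: "range A = \<A>"
    unfolding A_def using \<open>countable \<A>\<close> by (intro range_from_nat_into) (auto simp: \<A>_def)
  show thesis
  proof (rule that)
    fix i
    have "A i \<in> \<A>"
      using range_A by blast
    then show "open (A i)"
      by (auto simp: \<A>_def)
  next
    fix \<epsilon> :: real assume "0 < \<epsilon>"
    then obtain m where m: "1 / real (Suc m) < \<epsilon> / 2"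
      by (metis half_gt_zero nat_approx_posE)
    define B where "B x = ball x (1 / real (Suc m))" for x :: 't
    have "\<forall>x\<in>F m. \<exists>i. A i = B x"
      using range_A unfolding \<A>_def B_def by (metis (no_types, lifting) UN_I UNIV_I imageI insertI2 rangeE)
    then obtain j where j: "\<And>x. x \<in> F m \<Longrightarrow> A (j x) = B x"
      by metis
    \<comment> \<open>Large enough to include the indices of all balls of the m-th net.\<close>
    define N where "N = Suc (Max (insert 0 (j ` F m)))"
    have jN: "j x < N" if "x \<in> F m" for x
      unfolding N_def using that F(1) by (simp add: less_Suc_eq_le)
    have "dist x y < \<epsilon>" if eq: "\<forall>i<N. x \<in> A i \<longleftrightarrow> y \<in> A i" for x y
    proof -
      obtain z where z: "z \<in> F m" "x \<in> B z"
        using F(2)[of m] unfolding B_def by blast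
      then have "y \<in> B z"
        using eq jN[OF z(1)] j[OF z(1)] by metis
      then have "dist z x < \<epsilon> / 2" "dist z y < \<epsilon> / 2"
        using z(2) m by (auto simp: B_def)
      then show ?thesis
        by (metis dist_commute dist_triangle_half_r)
    qed
    then show "\<exists>N. \<forall>x y. (\<forall>i<N. x \<in> A i \<longleftrightarrow> y \<in> A i) \<longrightarrow> dist x y < \<epsilon>"
      by blast
  qed
qed

lemma integral_finite_code:
  fixes h :: "'c \<Rightarrow> real"
  assumes "prob_space Q" "finite S" "\<And>x. x \<in> space Q \<Longrightarrow> c x \<in> S"
    and "\<And>s. s \<in> S \<Longrightarrow> {x\<in>space Q. c x = s} \<in> sets Q"
  shows "(\<integral>x. h (c x) \<partial>Q) = (\<Sum>s\<in>S. h s * measure Q {x\<in>space Q. c x = s})"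
proof -
  interpret prob_space Q by fact
  have "(\<integral>x. h (c x) \<partial>Q) = (\<integral>x. (\<Sum>s\<in>S. h s * indicator {x\<in>space Q. c x = s} x) \<partial>Q)"
  proof (rule Bochner_Integration.integral_cong[OF refl])
    fix x assume x: "x \<in> space Q"
    have "(\<Sum>s\<in>S. h s * indicator {x\<in>space Q. c x = s} x) = (\<Sum>s\<in>S. if s = c x then h s else 0)"
      using x by (intro sum.cong) (auto simp: indicator_def)
    then show "h (c x) = (\<Sum>s\<in>S. h s * indicator {x\<in>space Q. c x = s} x)"
      using assms(2) assms(3)[OF x] by simp
  qed
  also have "\<dots> = (\<Sum>s\<in>S. \<integral>x. h s * indicator {x\<in>space Q. c x = s} x \<partial>Q)"
    using assms(4) by (intro Bochner_Integration.integral_sum) (auto simp: emeasure_eq_measure)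
  also have "\<dots> = (\<Sum>s\<in>S. h s * measure Q {x\<in>space Q. c x = s})"
    using assms(4) by (intro sum.cong) (auto simp: Int_absorb1)
  finally show ?thesis .
qed

text \<open>Tychonoff takes the place of a diagonal argument. With countably many coordinates the
  product is a metric space, so compactness gives convergent subsequences.\<close>

lemma unit_box_subsequence:
  fixes X :: "nat \<Rightarrow> 'i::countable \<Rightarrow> real"
  assumes "\<And>n i. 0 \<le> X n i" "\<And>n i. X n i \<le> 1"
  obtains \<phi> q where "strict_mono (\<phi> :: nat \<Rightarrow> nat)" "\<And>i. (\<lambda>n. X (\<phi> n) i) \<longlonglongrightarrow> q i"
proof -
  define K :: "('i \<Rightarrow> real) set" where "K = (\<Pi>\<^sub>E i\<in>UNIV. {0..1})"
  have "compactin (product_topology (\<lambda>_. euclidean) UNIV) K"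
    unfolding K_def by (subst compactin_PiE) auto
  then have "compact K"
    by (simp add: euclidean_product_topology)
  moreover have "\<forall>n. X n \<in> K"
    using assms by (auto simp: K_def)
  ultimately obtain q \<phi> where \<phi>: "strict_mono (\<phi> :: nat \<Rightarrow> nat)" "(X \<circ> \<phi>) \<longlonglongrightarrow> q"
    unfolding compact_def by blast
  have "(\<lambda>n. X (\<phi> n) i) \<longlonglongrightarrow> q i" for i
    using continuous_on_tendsto_compose[OF continuous_on_product_coordinates[of i] \<phi>(2)] by simp
  then show thesis
    using \<phi>(1) by (intro that)
qed

text \<open>The recursive subdivision of the unit interval turns consistent masses of the cells of a
  binary tree into Lebesgue measure.\<close>

context
  fixes q :: "bool list \<Rightarrow> real"
begin

text \<open>The newest bit stands at the head of the list. Node s owns the interval of length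
  \<open>q s\<close> that starts here; its False child takes the left part, its True child the right
  part.\<close>

primrec left_end :: "bool list \<Rightarrow> real" where
  "left_end [] = 0"
| "left_end (b # s) = left_end s + (if b then q (False # s) else 0)"

primrec address :: "nat \<Rightarrow> real \<Rightarrow> bool list" where
  "address 0 t = []"
| "address (Suc n) t = (left_end (address n t) + q (False # address n t) \<le> t) # address n t"

lemma length_address [simp]: "length (address n t) = n"
  by (induction n) auto

context
  assumes q_nonneg: "\<And>s. 0 \<le> q s" and q_Nil: "q [] = 1"
    and q_split: "\<And>s. q s = q (False # s) + q (True # s)"
begin

lemma left_end_bounds: "0 \<le> left_end s \<and> left_end s + q s \<le> 1"
proof (induction s)
  case Nil
  then show ?case by (simp add: q_Nil)
next
  case (Cons b s)
  then show ?case
    using q_split[of s] q_nonneg[of "False # s"] q_nonneg[of "True # s"] by (cases b) auto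
qed

lemma address_eq_iff:
  assumes "0 \<le> t" "t < 1" "length s = n"
  shows "address n t = s \<longleftrightarrow> left_end s \<le> t \<and> t < left_end s + q s"
  using assms(3)
proof (induction n arbitrary: s)
  case 0
  then show ?case using assms by (simp add: q_Nil)
next
  case (Suc n)
  then obtain b s' where s: "s = b # s'" "length s' = n"
    by (cases s) auto
  have "address (Suc n) t = s \<longleftrightarrow> address n t = s' \<and> (b \<longleftrightarrow> left_end s' + q (False # s') \<le> t)"
    by (auto simp: s)
  also have "\<dots> \<longleftrightarrow> left_end s' \<le> t \<and> t < left_end s' + q s' \<and> (b \<longleftrightarrow> left_end s' + q (False # s') \<le> t)"
    by (simp add: Suc.IH[OF s(2)])
  also have "\<dots> \<longleftrightarrow> left_end s \<le> t \<and> t < left_end s + q s"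
    using q_split[of s'] q_nonneg[of "False # s'"] q_nonneg[of "True # s'"] by (cases b) (auto simp: s)
  finally show ?case .
qed

lemma address_cell:
  assumes "length s = n"
  shows "{t\<in>{0..<1}. address n t = s} = {left_end s..<left_end s + q s}"
proof -
  have "t \<in> {0..<1} \<and> address n t = s \<longleftrightarrow> t \<in> {left_end s..<left_end s + q s}" for t
    using left_end_bounds[of s] address_eq_iff[of t, OF _ _ assms]
    by (cases "0 \<le> t \<and> t < 1") force+
  then show ?thesis by blast
qed

text \<open>The interval of a node of mass zero is empty, so no t is ever sent to such a node. This
  later guarantees a point to pick in the addressed cell.\<close>

lemma q_address_pos:
  assumes "t \<in> {0..<1}"
  shows "0 < q (address n t)"
  using address_eq_iff[of t "address n t" n] assms by simp

end

end

text \<open>Points are coded by membership in separating sets. Along a subsequence all cell masses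
  converge, to a consistent tree q; \<pi> is the law of a random point whose approximants have codes
  distributed according to q. The cells of \<pi> need not have mass \<open>q s\<close>, as F t may
  leave a cell in the limit; only integrals of continuous functions are compared.\<close>

lemma weak_limit_prior:
  fixes P :: "nat \<Rightarrow> 't::metric_space measure"
  assumes compact: "compact (UNIV :: 't set)" and P: "\<And>n. P n \<in> priors"
  obtains \<phi> \<pi> where "strict_mono (\<phi> :: nat \<Rightarrow> nat)" "\<pi> \<in> priors"
    "\<And>g :: 't \<Rightarrow> real. continuous_on UNIV g \<Longrightarrow> (\<lambda>n. \<integral>x. g x \<partial>P (\<phi> n)) \<longlonglongrightarrow> (\<integral>x. g x \<partial>\<pi>)"
proof -
  obtain A :: "nat \<Rightarrow> 't set" where A: "\<And>i. open (A i)"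
    "\<And>\<epsilon>. 0 < \<epsilon> \<Longrightarrow> \<exists>N. \<forall>x y. (\<forall>i<N. x \<in> A i \<longleftrightarrow> y \<in> A i) \<longrightarrow> dist x y < \<epsilon>"
    using compact_separating_sets[OF compact] by blast
  have P_prob: "prob_space (P n)" and P_sets [measurable_cong]: "sets (P n) = sets borel" for n
    using P by (auto simp: priors_def)
  have P_space: "space (P n) = UNIV" for n
    using sets_eq_imp_space_eq[OF P_sets] by simp
  define code where "code n x = rev (map (\<lambda>i. x \<in> A i) [0..<n])" for n x
  have code_Suc: "code (Suc n) x = (x \<in> A n) # code n x" and length_code [simp]: "length (code n x) = n" for n x
    by (auto simp: code_def)
  have code_eq_iff: "code n x = code n y \<longleftrightarrow> (\<forall>i<n. x \<in> A i \<longleftrightarrow> y \<in> A i)" for n x y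
    by (auto simp: code_def)
  define cell where "cell s = {x. code (length s) x = s}" for s
  have cell_Cons: "cell (b # s) = {x \<in> cell s. x \<in> A (length s) \<longleftrightarrow> b}" for b s
    by (auto simp: cell_def code_Suc)
  have cell_sets: "cell s \<in> sets borel" for s
  proof (induction s)
    case Nil
    then show ?case by (simp add: cell_def code_def)
  next
    case (Cons b s)
    have "cell (b # s) = (if b then cell s \<inter> A (length s) else cell s - A (length s))"
      by (auto simp: cell_Cons)
    then show ?case
      using Cons A(1) by auto
  qed
  obtain \<phi> q where \<phi>: "strict_mono (\<phi> :: nat \<Rightarrow> nat)"
    and lim: "\<And>s. (\<lambda>n. measure (P (\<phi> n)) (cell s)) \<longlonglongrightarrow> q s"
    by (rule unit_box_subsequence[of "\<lambda>n s. measure (P n) (cell s)"])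
      (auto simp: prob_space.prob_le_1[OF P_prob])
  have q_nonneg: "0 \<le> q s" for s
    by (rule LIMSEQ_le_const[OF lim]) auto
  have "measure (P n) (cell []) = 1" for n
    using prob_space.prob_space[OF P_prob] by (simp add: P_space cell_def code_def)
  then have q_Nil: "q [] = 1"
    using LIMSEQ_unique[OF lim[of "[]"]] by simp
  have q_split: "q s = q (False # s) + q (True # s)" for s
  proof -
    have eq: "measure (P n) (cell s) = measure (P n) (cell (False # s)) + measure (P n) (cell (True # s))" for n
    proof -
      interpret prob_space "P n" by (rule P_prob)
      have "cell s = cell (False # s) \<union> cell (True # s)"
        by (auto simp: cell_Cons)
      moreover have "cell (False # s) \<inter> cell (True # s) = {}"
        by (auto simp: cell_Cons)
      ultimately show ?thesis
        using finite_measure_Union[of "cell (False # s)" "cell (True # s)"] cell_sets by (simp add: P_sets)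
    qed
    have "(\<lambda>n. measure (P (\<phi> n)) (cell s)) \<longlonglongrightarrow> q (False # s) + q (True # s)"
      unfolding eq by (intro tendsto_add lim)
    then show ?thesis
      by (rule LIMSEQ_unique[OF lim])
  qed
  \<comment> \<open>An empty cell has mass 0 under every P n, hence in the limit.\<close>
  have cell_nonempty: "cell s \<noteq> {}" if "0 < q s" for s
    using that LIMSEQ_unique[OF lim[of s]] by force
  note q = q_nonneg q_Nil q_split
  define \<Omega> where "\<Omega> = restrict_space lborel {0..<1::real}"
  have space_\<Omega>: "space \<Omega> = {0..<1}"
    by (simp add: \<Omega>_def space_restrict_space)
  have prob_\<Omega>: "prob_space \<Omega>"
    by (intro prob_spaceI) (simp add: \<Omega>_def space_restrict_space emeasure_restrict_space)
  interpret \<Omega>: prob_space \<Omega> by (rule prob_\<Omega>)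
  have address_sets: "{t\<in>space \<Omega>. address q n t = s} \<in> sets \<Omega>"
    and address_measure: "length s = n \<Longrightarrow> measure \<Omega> {t\<in>space \<Omega>. address q n t = s} = q s" for n s
  proof -
    have sub: "{left_end q s..<left_end q s + q s} \<subseteq> {0..<1}"
      using left_end_bounds[OF q, of s] by auto
    show m: "measure \<Omega> {t\<in>space \<Omega>. address q n t = s} = q s" if "length s = n"
      unfolding space_\<Omega> address_cell[OF q that] unfolding \<Omega>_def
      using q_nonneg sub by (subst measure_restrict_space) auto
    show "{t\<in>space \<Omega>. address q n t = s} \<in> sets \<Omega>"
    proof (cases "length s = n")
      case True
      then show ?thesis
        unfolding space_\<Omega> address_cell[OF q True] unfolding \<Omega>_def
        using sub by (subst sets_restrict_space_iff) auto
    next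
      case False
      then have empty: "{t\<in>space \<Omega>. address q n t = s} = {}"
        by auto
      show ?thesis unfolding empty by (rule sets.empty_sets)
    qed
  qed
  define S where "S n = {s :: bool list. length s = n}" for n
  have finite_S: "finite (S n)" for n
    using finite_lists_length_eq[of "UNIV :: bool set" n] by (simp add: S_def)
  define pick where "pick s = (SOME x. x \<in> cell s)" for s
  define f where "f n t = pick (address q n t)" for n t
  have pick: "pick s \<in> cell s" if "cell s \<noteq> {}" for s
    unfolding pick_def using that by (simp add: some_in_eq)
  have code_f: "code n (f n t) = address q n t" if "t \<in> space \<Omega>" for n t
    using pick[OF cell_nonempty[OF q_address_pos[OF q]], of t n] that
    by (simp add: f_def cell_def space_\<Omega>)
  have code_f_le: "code n (f m t) = address q n t" if t: "t \<in> space \<Omega>" and "n \<le> m" for n m t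
  proof -
    have code_drop: "code n x = drop (m - n) (code m x)" for x
      using \<open>n \<le> m\<close> by (induction m rule: dec_induct) (auto simp: code_Suc Suc_diff_le)
    have "address q n t = drop (m - n) (address q m t)"
      using \<open>n \<le> m\<close> by (induction m rule: dec_induct) (auto simp: Suc_diff_le)
    then show ?thesis
      using code_drop code_f[OF t] by simp
  qed
  have f_meas: "f n \<in> borel_measurable \<Omega>" for n
  proof -
    have "address q n \<in> measurable \<Omega> (count_space UNIV)"
      using address_sets by (subst measurable_count_space_eq_countable) (auto simp: vimage_def Int_def conj_commute)
    then show ?thesis
      unfolding f_def[abs_def] by (rule measurable_compose) simp
  qed
  have "\<exists>l. (\<lambda>n. f n t) \<longlonglongrightarrow> l" if t: "t \<in> space \<Omega>" for t
  proof -
    have "Cauchy (\<lambda>n. f n t)"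
    proof (rule metric_CauchyI)
      fix e :: real assume "0 < e"
      then obtain N where N: "\<forall>x y. (\<forall>i<N. x \<in> A i \<longleftrightarrow> y \<in> A i) \<longrightarrow> dist x y < e"
        using A(2) by blast
      \<comment> \<open>Addresses only grow, so from step N on all approximants share their first N
        bits.\<close>
      have "dist (f m t) (f n t) < e" if "N \<le> m" "N \<le> n" for m n
        using N code_f_le[OF t that(1)] code_f_le[OF t that(2)] code_eq_iff by metis
      then show "\<exists>M. \<forall>m\<ge>M. \<forall>n\<ge>M. dist (f m t) (f n t) < e"
        by blast
    qed
    then show ?thesis
      using compact_imp_complete[OF compact] by (auto simp: complete_def)
  qed
  then obtain F where F: "\<And>t. t \<in> space \<Omega> \<Longrightarrow> (\<lambda>n. f n t) \<longlonglongrightarrow> F t"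
    by metis
  have F_meas [measurable]: "F \<in> borel_measurable \<Omega>"
    by (rule borel_measurable_LIMSEQ_metric[OF f_meas F])
  define \<pi> where "\<pi> = distr \<Omega> borel F"
  have \<pi>: "\<pi> \<in> priors"
    unfolding \<pi>_def priors_def using \<Omega>.prob_space_distr[OF F_meas] by simp
  have "(\<lambda>n. \<integral>x. g x \<partial>P (\<phi> n)) \<longlonglongrightarrow> (\<integral>x. g x \<partial>\<pi>)" if g: "continuous_on UNIV g" for g :: "'t \<Rightarrow> real"
  proof (rule metric_LIMSEQ_I)
    fix e :: real assume "0 < e"
    \<comment> \<open>Three errors of at most \<epsilon> will add up: discretising under P,
      convergence of the cell masses, and discretising under \<pi>.\<close>
    define \<epsilon> where "\<epsilon> = e / 4"
    have \<epsilon>: "0 < \<epsilon>" using \<open>0 < e\<close> by (simp add: \<epsilon>_def)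
    have g_meas [measurable]: "g \<in> borel_measurable borel"
      using g by (rule borel_measurable_continuous_onI)
    obtain G where G: "\<And>x. \<bar>g x\<bar> \<le> G"
      using compact_imp_bounded[OF compact_continuous_image[OF g compact]] by (auto simp: bounded_iff)
    obtain d where d: "0 < d" "\<And>x y. dist x y < d \<Longrightarrow> \<bar>g x - g y\<bar> < \<epsilon>"
      using compact_uniformly_continuous[OF g compact] \<epsilon>
      unfolding uniformly_continuous_on_def dist_real_def by (metis UNIV_I)
    obtain N where N: "\<And>x y. (\<forall>i<N. x \<in> A i \<longleftrightarrow> y \<in> A i) \<Longrightarrow> dist x y < d"
      using A(2)[OF d(1)] by blast
    have close: "\<bar>g x - g y\<bar> < \<epsilon>" if "code N x = code N y" for x y
      using that d(2) N unfolding code_eq_iff by blast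
    have int_diff: "\<bar>(\<integral>x. h x \<partial>Q) - (\<integral>x. h' x \<partial>Q)\<bar> \<le> \<epsilon>"
      if "prob_space Q" "\<And>x. x \<in> space Q \<Longrightarrow> \<bar>h x - h' x\<bar> \<le> \<epsilon>"
        "h \<in> borel_measurable Q" "h' \<in> borel_measurable Q" "\<And>x. \<bar>h x\<bar> \<le> G" "\<And>x. \<bar>h' x\<bar> \<le> G"
      for Q :: "'b measure" and h h' :: "'b \<Rightarrow> real"
    proof -
      interpret Q: prob_space Q by fact
      have i: "integrable Q h" "integrable Q h'"
        using that by (auto intro!: Q.integrable_const_bound[of _ G])
      have "\<bar>(\<integral>x. h x \<partial>Q) - (\<integral>x. h' x \<partial>Q)\<bar> = \<bar>\<integral>x. h x - h' x \<partial>Q\<bar>"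
        using i by simp
      also have "\<dots> \<le> (\<integral>x. \<bar>h x - h' x\<bar> \<partial>Q)"
        by (rule integral_abs_bound)
      also have "\<dots> \<le> (\<integral>x. \<epsilon> \<partial>Q)"
        using i that(2) by (intro integral_mono) auto
      finally show ?thesis
        using Q.prob_space by simp
    qed
    \<comment> \<open>A Riemann sum over the cells of depth N. It is linear in finitely many masses
      and thus continuous along the subsequence.\<close>
    define T where "T m = (\<Sum>s\<in>S N. g (pick s) * m s)" for m :: "bool list \<Rightarrow> real"
    have cell_N: "{x\<in>space (P n). code N x = s} = cell s" if "s \<in> S N" for n s
      using that by (auto simp: cell_def S_def P_space)
    have code_meas: "(\<lambda>x. g (pick (code N x))) \<in> borel_measurable (P n)" for n
    proof -
      have "code N -` {s} \<inter> space (P n) \<in> sets (P n)" for s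
      proof (cases "s \<in> S N")
        case True
        have "code N -` {s} \<inter> space (P n) = {x\<in>space (P n). code N x = s}" by auto
        then show ?thesis
          using cell_N[OF True] cell_sets by (simp add: P_sets)
      next
        case False
        then have "code N -` {s} \<inter> space (P n) = {}"
          by (auto simp: S_def)
        then show ?thesis by simp
      qed
      then have "code N \<in> measurable (P n) (count_space UNIV)"
        by (subst measurable_count_space_eq_countable) auto
      then show ?thesis
        by (rule measurable_compose) simp
    qed
    have 1: "\<bar>(\<integral>x. g x \<partial>P n) - T (\<lambda>s. measure (P n) (cell s))\<bar> \<le> \<epsilon>" for n
    proof -
      have "(\<integral>x. g (pick (code N x)) \<partial>P n) = T (\<lambda>s. measure (P n) (cell s))"
        unfolding T_def using cell_N cell_sets finite_S
        by (subst integral_finite_code[OF P_prob, of "S N"]) (auto simp: S_def P_sets)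
      moreover have "\<bar>(\<integral>x. g x \<partial>P n) - (\<integral>x. g (pick (code N x)) \<partial>P n)\<bar> \<le> \<epsilon>"
      proof (rule int_diff[OF P_prob])
        fix x
        have "x \<in> cell (code N x)"
          by (simp add: cell_def)
        then have "code N (pick (code N x)) = code N x"
          using pick[of "code N x"] by (auto simp: cell_def)
        then show "\<bar>g x - g (pick (code N x))\<bar> \<le> \<epsilon>"
          using close by (metis less_imp_le)
      qed (use G code_meas in auto)
      ultimately show ?thesis by simp
    qed
    have 2: "\<bar>T q - (\<integral>x. g x \<partial>\<pi>)\<bar> \<le> \<epsilon>"
    proof -
      have "T q = (\<integral>t. g (f N t) \<partial>\<Omega>)"
        unfolding T_def f_def using address_sets finite_S address_measure
        by (subst integral_finite_code[OF prob_\<Omega>, of "S N"]) (auto simp: S_def intro!: sum.cong)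
      moreover have "(\<integral>x. g x \<partial>\<pi>) = (\<integral>t. g (F t) \<partial>\<Omega>)"
        unfolding \<pi>_def by (rule integral_distr) measurable
      moreover have "\<bar>(\<integral>t. g (f N t) \<partial>\<Omega>) - (\<integral>t. g (F t) \<partial>\<Omega>)\<bar> \<le> \<epsilon>"
      proof (rule int_diff[OF prob_\<Omega>])
        fix t assume t: "t \<in> space \<Omega>"
        have "(\<lambda>n. g (f n t)) \<longlonglongrightarrow> g (F t)"
          using continuous_on_tendsto_compose[OF g F[OF t]] by simp
        then have "(\<lambda>n. \<bar>g (f N t) - g (f n t)\<bar>) \<longlonglongrightarrow> \<bar>g (f N t) - g (F t)\<bar>"
          by (intro tendsto_intros)
        \<comment> \<open>The comparison is made before the limit, where the codes still agree; the
          non-strict bound then survives n \<rightarrow> \<infinity>.\<close>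
        moreover have "\<bar>g (f N t) - g (f n t)\<bar> \<le> \<epsilon>" if "N \<le> n" for n
          using close[of "f N t" "f n t"] code_f_le[OF t that] code_f[OF t, of N] by simp
        ultimately show "\<bar>g (f N t) - g (F t)\<bar> \<le> \<epsilon>"
          by (intro LIMSEQ_le_const2) auto
      next
        show "(\<lambda>t. g (f N t)) \<in> borel_measurable \<Omega>"
          by (rule measurable_compose[OF f_meas g_meas])
      qed (use G in auto)
      ultimately show ?thesis by simp
    qed
    have "(\<lambda>n. T (\<lambda>s. measure (P (\<phi> n)) (cell s))) \<longlonglongrightarrow> T q"
      unfolding T_def by (intro tendsto_intros lim)
    then obtain n0 where n0: "\<And>n. n0 \<le> n \<Longrightarrow> \<bar>T (\<lambda>s. measure (P (\<phi> n)) (cell s)) - T q\<bar> < \<epsilon>"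
      using \<epsilon> unfolding LIMSEQ_iff real_norm_def by blast
    have "dist (\<integral>x. g x \<partial>P (\<phi> n)) (\<integral>x. g x \<partial>\<pi>) < e" if "n0 \<le> n" for n
      using 1[of "\<phi> n"] 2 n0[OF that] \<epsilon> unfolding dist_real_def \<epsilon>_def by linarith
    then show "\<exists>no. \<forall>n\<ge>no. dist (\<integral>x. g x \<partial>P (\<phi> n)) (\<integral>x. g x \<partial>\<pi>) < e"
      by blast
  qed
  then show thesis
    by (rule that[OF \<phi> \<pi>])
qed

section \<open>The least favorable prior\<close>

lemma discrete_prior:
  fixes I :: "'t::topological_space set"
  assumes I: "finite I" and p: "\<And>i. i \<in> I \<Longrightarrow> 0 \<le> p i" "sum p I = 1"
  obtains P where "P \<in> priors"
    "\<And>g :: 't \<Rightarrow> real. g \<in> borel_measurable borel \<Longrightarrow> (\<integral>x. g x \<partial>P) = (\<Sum>i\<in>I. p i * g i)"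
proof -
  define Q where "Q = point_measure I (\<lambda>i. ennreal (p i))"
  have Q_meas: "(\<lambda>x. x) \<in> measurable Q borel"
    by (auto simp: Q_def measurable_def space_point_measure sets_point_measure)
  have "emeasure Q (space Q) = 1"
    using I p by (simp add: Q_def space_point_measure emeasure_point_measure_finite sum_ennreal)
  then interpret Q: prob_space Q by (rule prob_spaceI)
  show thesis
  proof (rule that[of "distr Q borel (\<lambda>x. x)"])
    show "distr Q borel (\<lambda>x. x) \<in> priors"
      using Q.prob_space_distr[OF Q_meas] by (simp add: priors_def)
    fix g :: "'t \<Rightarrow> real" assume "g \<in> borel_measurable borel"
    then have "(\<integral>x. g x \<partial>distr Q borel (\<lambda>x. x)) = (\<integral>x. g x \<partial>Q)"
      by (rule integral_distr[OF Q_meas])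
    also have "\<dots> = (\<Sum>i\<in>I. p i * g i)"
      unfolding Q_def using I p by (simp add: lebesgue_integral_point_measure_finite)
    finally show "(\<integral>x. g x \<partial>distr Q borel (\<lambda>x. x)) = (\<Sum>i\<in>I. p i * g i)" .
  qed
qed

context quantum_decision
begin

lemma continuous_risk:
  assumes M: "M \<in> Povm"
  shows "continuous_on UNIV (risk \<rho> w M)"
  unfolding continuous_on_iff
proof (intro ballI allI impI)
  fix \<theta> :: 't and e :: real assume "0 < e"
  then obtain \<delta> where "0 < \<delta>" "\<And>M \<theta> \<eta>. M \<in> Povm \<Longrightarrow> dist \<theta> \<eta> < \<delta> \<Longrightarrow> \<bar>risk \<rho> w M \<theta> - risk \<rho> w M \<eta>\<bar> \<le> e / 2"
    using risk_equicontinuous[of "e / 2"] by auto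
  then show "\<exists>d>0. \<forall>\<eta>\<in>UNIV. dist \<eta> \<theta> < d \<longrightarrow> dist (risk \<rho> w M \<eta>) (risk \<rho> w M \<theta>) < e"
    using M \<open>0 < e\<close> by (intro exI[of _ \<delta>]) (fastforce simp: dist_real_def)
qed

lemma bdd_above_risk: "M \<in> Povm \<Longrightarrow> bdd_above (range (risk \<rho> w M))"
  using risk_le loss_bounded by (metis bdd_aboveI2)

lemma integral_risk_le_SUP:
  assumes "\<pi> \<in> priors" "M \<in> Povm"
  shows "(\<integral>\<theta>. risk \<rho> w M \<theta> \<partial>\<pi>) \<le> (SUP \<theta>. risk \<rho> w M \<theta>)"
proof -
  interpret prob_space \<pi> using assms(1) by (simp add: priors_def)
  have sets: "sets \<pi> = sets borel" using assms(1) by (simp add: priors_def)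
  have le: "risk \<rho> w M \<theta> \<le> (SUP \<theta>. risk \<rho> w M \<theta>)" for \<theta>
    using bdd_above_risk[OF assms(2)] by (intro cSUP_upper) auto
  have "risk \<rho> w M \<in> borel_measurable \<pi>"
    using borel_measurable_continuous_onI[OF continuous_risk[OF assms(2)]]
      measurable_cong_sets[OF sets refl] by blast
  then have "integrable \<pi> (risk \<rho> w M)"
    using le risk_nonneg by (intro integrable_const_bound[of _ "SUP \<theta>. risk \<rho> w M \<theta>"]) auto
  then show ?thesis
    by (intro integral_le_const) (auto simp: le)
qed

abbreviation "minimax_risk \<equiv> (INF M\<in>Povm. SUP \<theta>. risk \<rho> w M \<theta>)"

lemma minimax_risk_le_SUP:
  assumes M: "M \<in> Povm"
  shows "minimax_risk \<le> (SUP \<theta>. risk \<rho> w M \<theta>)"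
proof (rule cINF_lower[OF _ M])
  have "0 \<le> (SUP \<theta>. risk \<rho> w M \<theta>)" if "M \<in> Povm" for M
    by (rule cSUP_upper2[OF bdd_above_risk[OF that] UNIV_I risk_nonneg])
  then show "bdd_below ((\<lambda>M. SUP \<theta>. risk \<rho> w M \<theta>) ` Povm)"
    by (auto intro!: bdd_belowI2)
qed

text \<open>Every risk function reaches the minimax risk at its maximum, hence comes within e of it
  at some net point. So after subtracting \<open>minimax_risk - e\<close> each risk function has a
  nonnegative value on the finite net, which is the hypothesis of
  \<open>finite_minimax_weights\<close>.\<close>

lemma approx_least_favorable:
  assumes e: "0 < e"
  obtains P where "P \<in> priors" "\<And>M. M \<in> Povm \<Longrightarrow> minimax_risk - e \<le> (\<integral>\<theta>. risk \<rho> w M \<theta> \<partial>P)"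
proof -
  obtain \<delta> where \<delta>: "0 < \<delta>"
    "\<And>M \<theta> \<eta>. M \<in> Povm \<Longrightarrow> dist \<theta> \<eta> < \<delta> \<Longrightarrow> \<bar>risk \<rho> w M \<theta> - risk \<rho> w M \<eta>\<bar> \<le> e"
    using risk_equicontinuous[OF e] by blast
  obtain I :: "'t set" where I: "finite I" "UNIV \<subseteq> (\<Union>x\<in>I. ball x \<delta>)"
    using compact_params \<delta>(1) unfolding compact_eq_totally_bounded by blast
  then have "I \<noteq> {}" by auto
  define V where "V = (\<lambda>M \<theta>. risk \<rho> w M \<theta> - (minimax_risk - e)) ` Povm"
  have "\<exists>p. (\<forall>i\<in>I. 0 \<le> p i) \<and> sum p I = 1 \<and> (\<forall>v\<in>V. 0 \<le> (\<Sum>i\<in>I. p i * v i))"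
  proof (rule finite_minimax_weights[OF I(1) \<open>I \<noteq> {}\<close>])
    fix u v :: "'t \<Rightarrow> real" and t :: real
    assume "u \<in> V" "v \<in> V" and t: "0 \<le> t" "t \<le> 1"
    then obtain M N where MN: "M \<in> Povm" "N \<in> Povm" "u = (\<lambda>\<theta>. risk \<rho> w M \<theta> - (minimax_risk - e))"
      "v = (\<lambda>\<theta>. risk \<rho> w N \<theta> - (minimax_risk - e))"
      by (auto simp: V_def)
    have "(\<lambda>\<theta>. t * u \<theta> + (1 - t) * v \<theta>)
        = (\<lambda>\<theta>. risk \<rho> w (povm_mix t M N) \<theta> - (minimax_risk - e))"
      unfolding MN(3,4) risk_mix[OF t MN(1,2)] by (simp add: algebra_simps)
    then show "(\<lambda>\<theta>. t * u \<theta> + (1 - t) * v \<theta>) \<in> V"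
      using povm_mix_Povm[OF t MN(1,2)] by (simp add: V_def)
  next
    fix v assume "v \<in> V"
    then obtain M where M: "M \<in> Povm" "v = (\<lambda>\<theta>. risk \<rho> w M \<theta> - (minimax_risk - e))"
      by (auto simp: V_def)
    obtain \<theta> where \<theta>: "\<And>\<eta>. risk \<rho> w M \<eta> \<le> risk \<rho> w M \<theta>"
      using continuous_attains_sup[OF compact_params _ continuous_risk[OF M(1)]] by auto
    have "minimax_risk \<le> risk \<rho> w M \<theta>"
      using minimax_risk_le_SUP[OF M(1)] cSUP_least[of UNIV "risk \<rho> w M", OF _ \<theta>] by simp
    moreover obtain i where "i \<in> I" "dist i \<theta> < \<delta>"
      using subsetD[OF I(2) UNIV_I[of \<theta>]] by auto
    ultimately show "\<exists>i\<in>I. 0 \<le> v i"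
      using \<delta>(2)[OF M(1), of i \<theta>] by (intro bexI[of _ i]) (auto simp: M(2))
  qed
  then obtain p where p: "\<And>i. i \<in> I \<Longrightarrow> 0 \<le> p i" "sum p I = 1"
    and pV: "\<And>v. v \<in> V \<Longrightarrow> 0 \<le> (\<Sum>i\<in>I. p i * v i)"
    by blast
  obtain P where P: "P \<in> priors"
    "\<And>g :: 't \<Rightarrow> real. g \<in> borel_measurable borel \<Longrightarrow> (\<integral>x. g x \<partial>P) = (\<Sum>i\<in>I. p i * g i)"
    using discrete_prior[of I p] I(1) p by blast
  show thesis
  proof (rule that[OF P(1)])
    fix M :: "'u set \<Rightarrow> 'h \<Rightarrow> 'h" assume M: "M \<in> Povm"
    have "0 \<le> (\<Sum>i\<in>I. p i * (risk \<rho> w M i - (minimax_risk - e)))"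
      using pV[of "\<lambda>\<theta>. risk \<rho> w M \<theta> - (minimax_risk - e)"] M by (simp add: V_def)
    also have "\<dots> = (\<Sum>i\<in>I. p i * risk \<rho> w M i) - (\<Sum>i\<in>I. p i) * (minimax_risk - e)"
      by (simp only: right_diff_distrib sum_subtractf sum_distrib_right)
    finally show "minimax_risk - e \<le> (\<integral>\<theta>. risk \<rho> w M \<theta> \<partial>P)"
      using P(2)[OF borel_measurable_continuous_onI[OF continuous_risk[OF M]]] p(2) by simp
  qed
qed

text \<open>The errors 1 / (n + 1) vanish along the subsequence while, for each fixed M, the Bayes
  risks converge because R_M is continuous.\<close>

lemma least_favorable_prior:
  obtains \<pi> where "\<pi> \<in> priors" "\<And>M. M \<in> Povm \<Longrightarrow> minimax_risk \<le> (\<integral>\<theta>. risk \<rho> w M \<theta> \<partial>\<pi>)"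
proof -
  have "\<exists>P\<in>priors. \<forall>M\<in>Povm. minimax_risk - 1 / real (Suc n) \<le> (\<integral>\<theta>. risk \<rho> w M \<theta> \<partial>P)" for n
    using approx_least_favorable[of "1 / real (Suc n)"] by (metis zero_less_divide_1_iff of_nat_0_less_iff zero_less_Suc)
  then obtain P where P: "\<And>n. P n \<in> priors"
    "\<And>n M. M \<in> Povm \<Longrightarrow> minimax_risk - 1 / real (Suc n) \<le> (\<integral>\<theta>. risk \<rho> w M \<theta> \<partial>P n)"
    by metis
  obtain \<phi> \<pi> where \<phi>: "strict_mono (\<phi> :: nat \<Rightarrow> nat)" and \<pi>: "\<pi> \<in> priors"
    and lim: "\<And>g :: 't \<Rightarrow> real. continuous_on UNIV g \<Longrightarrow> (\<lambda>n. \<integral>x. g x \<partial>P (\<phi> n)) \<longlonglongrightarrow> (\<integral>x. g x \<partial>\<pi>)"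
    using weak_limit_prior[of P, OF compact_params P(1)] by blast
  show thesis
  proof (rule that[OF \<pi>])
    fix M :: "'u set \<Rightarrow> 'h \<Rightarrow> 'h" assume M: "M \<in> Povm"
    have "(\<lambda>n. 1 / real (Suc (\<phi> n))) \<longlonglongrightarrow> 0"
      using LIMSEQ_subseq_LIMSEQ[OF LIMSEQ_Suc[OF lim_1_over_n] \<phi>] by (simp add: o_def)
    then have "(\<lambda>n. minimax_risk - 1 / real (Suc (\<phi> n))) \<longlonglongrightarrow> minimax_risk - 0"
      by (intro tendsto_diff tendsto_const)
    then have "minimax_risk - 0 \<le> (\<integral>\<theta>. risk \<rho> w M \<theta> \<partial>\<pi>)"
      by (rule LIMSEQ_le[OF _ lim[OF continuous_risk[OF M]]]) (use P(2)[OF M] in blast)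
    then show "minimax_risk \<le> (\<integral>\<theta>. risk \<rho> w M \<theta> \<partial>\<pi>)"
      by simp
  qed
qed

lemma bayes_risk_le_minimax:
  assumes \<pi>: "\<pi> \<in> priors"
  shows "(INF M\<in>Povm. \<integral>\<theta>. risk \<rho> w M \<theta> \<partial>\<pi>) \<le> minimax_risk"
proof (rule cINF_mono[OF Povm_nonempty])
  show "bdd_below ((\<lambda>M. \<integral>\<theta>. risk \<rho> w M \<theta> \<partial>\<pi>) ` Povm)"
    using risk_nonneg by (auto intro!: bdd_belowI2[of _ 0] Bochner_Integration.integral_nonneg)
  show "\<exists>N\<in>Povm. (\<integral>\<theta>. risk \<rho> w N \<theta> \<partial>\<pi>) \<le> (SUP \<theta>. risk \<rho> w M \<theta>)" if "M \<in> Povm" for M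
    using integral_risk_le_SUP[OF \<pi> that] that by blast
qed

end

theorem theorem4:
  fixes \<rho> :: "'t::metric_space \<Rightarrow> 'h::chilbert \<Rightarrow> 'h"
    and w :: "'t \<Rightarrow> 'u::metric_space \<Rightarrow> real"
  assumes "compact (UNIV :: 't set)" and "compact (UNIV :: 'u set)"
    and "quantum_model \<rho>"
    and "continuous_on UNIV (\<lambda>(\<theta>, u). w \<theta> u)"
    and "\<And>\<theta> u. 0 \<le> w \<theta> u"
  shows "\<exists>\<pi>LF\<in>priors.
     (INF M\<in>Povm. \<integral>\<theta>. risk \<rho> w M \<theta> \<partial>\<pi>LF)
        = (SUP \<pi>\<in>priors. INF M\<in>Povm. \<integral>\<theta>. risk \<rho> w M \<theta> \<partial>\<pi>)
     \<and> (\<forall>Ms\<in>Povm. (SUP \<theta>. risk \<rho> w Ms \<theta>) = (INF M\<in>Povm. SUP \<theta>. risk \<rho> w M \<theta>)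
          \<longrightarrow> (\<integral>\<theta>. risk \<rho> w Ms \<theta> \<partial>\<pi>LF) = (INF M\<in>Povm. \<integral>\<theta>. risk \<rho> w M \<theta> \<partial>\<pi>LF))"
proof -
  interpret quantum_decision \<rho> w
    by unfold_locales (use assms in auto)
  obtain \<pi> where \<pi>: "\<pi> \<in> priors"
    and fav: "\<And>M. M \<in> Povm \<Longrightarrow> minimax_risk \<le> (\<integral>\<theta>. risk \<rho> w M \<theta> \<partial>\<pi>)"
    using least_favorable_prior by blast
  have "minimax_risk \<le> (INF M\<in>Povm. \<integral>\<theta>. risk \<rho> w M \<theta> \<partial>\<pi>)"
    using fav by (intro cINF_greatest Povm_nonempty)
  then have bayes: "(INF M\<in>Povm. \<integral>\<theta>. risk \<rho> w M \<theta> \<partial>\<pi>) = minimax_risk"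
    using bayes_risk_le_minimax[OF \<pi>] by (rule antisym[rotated])
  have "(SUP \<pi>\<in>priors. INF M\<in>Povm. \<integral>\<theta>. risk \<rho> w M \<theta> \<partial>\<pi>) = minimax_risk"
  proof (rule antisym)
    show "(SUP \<pi>\<in>priors. INF M\<in>Povm. \<integral>\<theta>. risk \<rho> w M \<theta> \<partial>\<pi>) \<le> minimax_risk"
      using \<pi> bayes_risk_le_minimax by (intro cSUP_least) auto
    \<comment> \<open>The supremum is taken in the reals, so attaining it from below requires an
      explicit upper bound; weak duality supplies one.\<close>
    have "bdd_above ((\<lambda>\<pi>. INF M\<in>Povm. \<integral>\<theta>. risk \<rho> w M \<theta> \<partial>\<pi>) ` priors)"
      using bayes_risk_le_minimax by (rule bdd_aboveI2)
    then show "minimax_risk \<le> (SUP \<pi>\<in>priors. INF M\<in>Povm. \<integral>\<theta>. risk \<rho> w M \<theta> \<partial>\<pi>)"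
      using bayes by (intro cSUP_upper2[OF _ \<pi>]) simp_all
  qed
  moreover have "(\<integral>\<theta>. risk \<rho> w Ms \<theta> \<partial>\<pi>) = minimax_risk"
    if "Ms \<in> Povm" "(SUP \<theta>. risk \<rho> w Ms \<theta>) = minimax_risk" for Ms
    using integral_risk_le_SUP[OF \<pi> that(1)] fav[OF that(1)] that(2) by simp
  ultimately show ?thesis
    using \<pi> bayes by (intro bexI[of _ \<pi>]) simp_all
qed

end
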